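(* Let $\mathcal{E},\mathcal{E}'$ be separable complex Hilbert spaces and let $T,T'$ be two contractions from $\mathcal{E}$ into $\mathcal{E}'$. The following are equivalent: (i) $T$ and $T'$ are in the same Shmul'yan part (i.e. are Shmul'yan equivalent); (ii) there exist $\lambda_0\in\mathbb{D}$ and $F\in H_1^\infty(\mathcal{E},\mathcal{E}')$ such that $F(0)=T$ and $F(\lambda_0)=T'$; (iii) $\delta_K(T,T')<\infty$.
   Context: $\mathbb{D}$ is the open unit disc. $\mathcal{B}_1(\mathcal{E},\mathcal{E}')$ is the set of contractions (bounded linear operators of norm $\le 1$) from $\mathcal{E}$ to $\mathcal{E}'$. $H_1^\infty(\mathcal{E},\mathcal{E}')$ is the set of analytic functions $F:\mathbb{D}\to\mathcal{B}(\mathcal{E},\mathcal{E}')$ with $\|F(z)\|\le 1$ for all $z\in\mathbb{D}$. For a contraction $A$, $D_A=(I-A^*A)^{1/2}$ and $\mathcal{D}_A=\overline{\mathcal{R}(D_A)}$. For $A,B\in\mathcal{B}_1(\mathcal{E},\mathcal{E}')$, $A$ Shmul'yan dominates $B$ if $B=A+D_{A^*}XD_A$ for some bounded $X\in\mathcal{B}(\mathcal{D}_A,\mathcal{D}_{A^*})$; $A$ and $B$ are Shmul'yan equivalent if each Shmul'yan dominates the other, and the equivalence classes are called Shmul'yan parts. The hyperbolic metric on $\mathbb{D}$ is $\delta(z,\mu)=\tanh^{-1}\left|\frac{z-\mu}{1-\overline{\mu}z}\right|$. The Kobayashi pseudo-distance $\delta_K:\mathcal{B}_1(\mathcal{E},\mathcal{E}')\times\mathcal{B}_1(\mathcal{E},\mathcal{E}')\to[0,\infty]$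 is $\delta_K(T,T')=\inf\sum_{j=1}^n\delta(0,\lambda_j)$, the infimum being over all finite systems $\{\lambda_j\}_{j=1}^n\subset\mathbb{D}$ for which there exist $\{F_j\}_{j=1}^n\subset H_1^\infty(\mathcal{E},\mathcal{E}')$ with $F_1(0)=T$, $F_j(\lambda_j)=F_{j+1}(0)$ for $1\le j\le n-1$, and $F_n(\lambda_n)=T'$; $\delta_K(T,T')=\infty$ if no such systems exist. *)

theory Defs
  imports "HOL-Analysis.Analysis"
begin

text \<open>Complex Hilbert spaces, as a class extension of the real normed spaces of the library, so that
  the topology, the norm and the bounded operators \<^typ>\<open>'a \<Rightarrow>\<^sub>L 'b\<close> are the library ones.\<close>

class complex_vector = real_vector +
  fixes scaleC :: "complex \<Rightarrow> 'a \<Rightarrow> 'a"  (infixr \<open>*\<^sub>C\<close> 75)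
  assumes scaleC_add_right: "c *\<^sub>C (x + y) = c *\<^sub>C x + c *\<^sub>C y"
    and scaleC_add_left: "(c + d) *\<^sub>C x = c *\<^sub>C x + d *\<^sub>C x"
    and scaleC_scaleC: "c *\<^sub>C d *\<^sub>C x = (c * d) *\<^sub>C x"
    and scaleC_one: "1 *\<^sub>C x = x"
    and scaleR_scaleC: "r *\<^sub>R x = complex_of_real r *\<^sub>C x"

class complex_normed_vector = complex_vector + real_normed_vector +
  assumes norm_scaleC: "norm (c *\<^sub>C x) = cmod c * norm x"

text \<open>The inner product is linear in the first argument. Positive definiteness is contained in
  \<open>cinner_self\<close>, the norm being definite.\<close>

class complex_inner = complex_normed_vector +
  fixes cinner :: "'a \<Rightarrow> 'a \<Rightarrow> complex"
  assumes cinner_commute: "cinner x y = cnj (cinner y x)"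
    and cinner_add_left: "cinner (x + y) z = cinner x z + cinner y z"
    and cinner_scaleC_left: "cinner (c *\<^sub>C x) y = c * cinner x y"
    and cinner_self: "cinner x x = complex_of_real ((norm x)\<^sup>2)"

class complex_hilbert = complex_inner + complete_space

instantiation complex :: complex_hilbert
begin

definition scaleC_complex :: "complex \<Rightarrow> complex \<Rightarrow> complex"
  where "scaleC_complex c x = c * x"

definition cinner_complex :: "complex \<Rightarrow> complex \<Rightarrow> complex"
  where "cinner_complex x y = x * cnj y"

instance
proof
  fix c d x y z :: complex and r :: real
  show "cinner x x = complex_of_real ((norm x)\<^sup>2)"
    by (simp add: cinner_complex_def complex_norm_square[symmetric])
qed (simp_all add: scaleC_complex_def cinner_complex_def ring_distribs scaleR_conv_of_real norm_mult)

end

lemma bounded_linear_scaleC_right: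
  "bounded_linear (\<lambda>x :: 'a :: complex_normed_vector. c *\<^sub>C x)"
proof (rule bounded_linear_intro[where K = "cmod c"])
  show "c *\<^sub>C (r *\<^sub>R x) = r *\<^sub>R (c *\<^sub>C x)" for r and x :: 'a
    by (simp add: scaleR_scaleC scaleC_scaleC mult.commute)
qed (simp_all add: scaleC_add_right norm_scaleC mult.commute)

text \<open>An element of \<^typ>\<open>'a \<Rightarrow>\<^sub>L 'b\<close> is only real linear; the pointwise scaling makes the whole type a
  complex normed space, in which the complex linear operators form a closed subspace.\<close>

instantiation blinfun :: (real_normed_vector, complex_normed_vector) complex_normed_vector
begin

lift_definition scaleC_blinfun :: "complex \<Rightarrow> 'a \<Rightarrow>\<^sub>L 'b \<Rightarrow> 'a \<Rightarrow>\<^sub>L 'b"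
  is "\<lambda>c f x. c *\<^sub>C f x"
  by (rule bounded_linear_compose[OF bounded_linear_scaleC_right])

instance
proof
  fix c d :: complex and r :: real and f g :: "'a \<Rightarrow>\<^sub>L 'b"
  show "c *\<^sub>C (f + g) = c *\<^sub>C f + c *\<^sub>C g"
    by transfer (simp add: scaleC_add_right)
  show "(c + d) *\<^sub>C f = c *\<^sub>C f + d *\<^sub>C f"
    by transfer (simp add: scaleC_add_left)
  show "c *\<^sub>C d *\<^sub>C f = (c * d) *\<^sub>C f"
    by transfer (simp add: scaleC_scaleC)
  show "1 *\<^sub>C f = f"
    by transfer (simp add: scaleC_one)
  show "r *\<^sub>R f = complex_of_real r *\<^sub>C f"
    by transfer (simp add: scaleR_scaleC)
  have "norm (c *\<^sub>C f) = onorm (\<lambda>x. cmod c *\<^sub>R blinfun_apply f x)"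
    by transfer (simp add: onorm_def norm_scaleC)
  also have "\<dots> = cmod c * norm f"
    by transfer (simp add: onorm_scaleR)
  finally show "norm (c *\<^sub>C f) = cmod c * norm f" .
qed

end

text \<open>\<open>\<B>(\<E>, \<E>')\<close> as a set of library operators, and its closed unit ball.\<close>

definition clinear_op :: "('a :: complex_normed_vector \<Rightarrow>\<^sub>L 'b :: complex_normed_vector) set"
  where "clinear_op = {A :: 'a \<Rightarrow>\<^sub>L 'b. \<forall>c x. A (c *\<^sub>C x) = c *\<^sub>C A x}"

definition contractions :: "('a :: complex_normed_vector \<Rightarrow>\<^sub>L 'b :: complex_normed_vector) set"
  where "contractions = {A \<in> clinear_op. norm A \<le> 1}"

definition adjoint_op :: "('a :: complex_hilbert \<Rightarrow>\<^sub>L 'b :: complex_hilbert) \<Rightarrow> 'b \<Rightarrow>\<^sub>L 'a"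
  where "adjoint_op A = (THE B :: 'b \<Rightarrow>\<^sub>L 'a. B \<in> clinear_op \<and> (\<forall>x y. cinner (A x) y = cinner x (B y)))"

definition positive_op :: "('a :: complex_hilbert \<Rightarrow>\<^sub>L 'a) \<Rightarrow> bool"
  where "positive_op P \<longleftrightarrow> P \<in> clinear_op \<and> (\<forall>x. cinner (P x) x \<in> \<real>\<^sub>\<ge>\<^sub>0)"

definition sqrt_op :: "('a :: complex_hilbert \<Rightarrow>\<^sub>L 'a) \<Rightarrow> 'a \<Rightarrow>\<^sub>L 'a"
  where "sqrt_op P = (THE Q. positive_op Q \<and> Q o\<^sub>L Q = P)"

definition defect_op :: "('a :: complex_hilbert \<Rightarrow>\<^sub>L 'b :: complex_hilbert) \<Rightarrow> 'a \<Rightarrow>\<^sub>L 'a"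
  where "defect_op A = sqrt_op (id_blinfun - (adjoint_op A o\<^sub>L A))"

definition defect_space :: "('a :: complex_hilbert \<Rightarrow>\<^sub>L 'b :: complex_hilbert) \<Rightarrow> 'a set"
  where "defect_space A = closure (range (defect_op A))"

text \<open>\<open>\<B>(S, S')\<close> for subspaces \<open>S\<close> and \<open>S'\<close>; the values of \<open>X\<close> outside \<open>S\<close> are irrelevant.\<close>

definition bounded_op_between ::
    "'a :: complex_normed_vector set \<Rightarrow> 'b :: complex_normed_vector set \<Rightarrow> ('a \<Rightarrow> 'b) \<Rightarrow> bool"
  where "bounded_op_between S S' X \<longleftrightarrow>
    X ` S \<subseteq> S' \<and>
    (\<forall>x\<in>S. \<forall>y\<in>S. X (x + y) = X x + X y) \<and>
    (\<forall>c. \<forall>x\<in>S. X (c *\<^sub>C x) = c *\<^sub>C X x) \<and>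
    (\<exists>K. \<forall>x\<in>S. norm (X x) \<le> K * norm x)"

definition shmulyan_dominates ::
    "('a :: complex_hilbert \<Rightarrow>\<^sub>L 'b :: complex_hilbert) \<Rightarrow> ('a \<Rightarrow>\<^sub>L 'b) \<Rightarrow> bool"
  where "shmulyan_dominates A B \<longleftrightarrow>
    (\<exists>X. bounded_op_between (defect_space A) (defect_space (adjoint_op A)) X \<and>
      (\<forall>x. B x = A x + defect_op (adjoint_op A) (X (defect_op A x))))"

definition shmulyan_equivalent ::
    "('a :: complex_hilbert \<Rightarrow>\<^sub>L 'b :: complex_hilbert) \<Rightarrow> ('a \<Rightarrow>\<^sub>L 'b) \<Rightarrow> bool"
  where "shmulyan_equivalent A B \<longleftrightarrow> shmulyan_dominates A B \<and> shmulyan_dominates B A"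

abbreviation unit_disc :: "complex set"
  where "unit_disc \<equiv> ball 0 1"

definition vector_analytic_on ::
    "(complex \<Rightarrow> 'a :: complex_normed_vector) \<Rightarrow> complex set \<Rightarrow> bool"  (infix \<open>vector'_analytic'_on\<close> 50)
  where "F vector_analytic_on S \<longleftrightarrow> (\<forall>z\<in>S. \<exists>D. (F has_derivative (\<lambda>h. h *\<^sub>C D)) (at z))"

definition schur_class ::
    "(complex \<Rightarrow> 'a :: complex_normed_vector \<Rightarrow>\<^sub>L 'b :: complex_normed_vector) set"
  where "schur_class =
    {F. F vector_analytic_on unit_disc \<and> (\<forall>z\<in>unit_disc. F z \<in> clinear_op \<and> norm (F z) \<le> 1)}"

definition hyperbolic_dist :: "complex \<Rightarrow> complex \<Rightarrow> real"
  where "hyperbolic_dist z \<mu> = artanh (cmod ((z - \<mu>) / (1 - cnj \<mu> * z)))"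

text \<open>The infimum of the empty set in \<^typ>\<open>ennreal\<close> is \<open>\<infinity>\<close>.\<close>

definition kobayashi_dist ::
    "('a :: complex_normed_vector \<Rightarrow>\<^sub>L 'b :: complex_normed_vector) \<Rightarrow> ('a \<Rightarrow>\<^sub>L 'b) \<Rightarrow> ennreal"
  where "kobayashi_dist T T' =
    Inf {ennreal (\<Sum>j=1..n. hyperbolic_dist 0 (l j)) | (n :: nat) (l :: nat \<Rightarrow> complex).
      1 \<le> n \<and> (\<forall>j\<in>{1..n}. l j \<in> unit_disc) \<and>
      (\<exists>F :: nat \<Rightarrow> complex \<Rightarrow> 'a \<Rightarrow>\<^sub>L 'b.
        (\<forall>j\<in>{1..n}. F j \<in> schur_class) \<and>
        F 1 0 = T \<and>
        (\<forall>j\<in>{1..<n}. F j (l j) = F (j + 1) 0) \<and>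
        F n (l n) = T')}"

end

theory Submission
  imports Defs "HOL-Complex_Analysis.Conformal_Mappings"
begin

text \<open>The three conditions are compared with a fourth one, an equivalence relation that involves no
  defect operators: \<open>T\<close> and \<open>T'\<close> are Pick equivalent if \<open>\<bar>\<langle>x, x\<rangle> - \<langle>T' x, T x\<rangle>\<bar>\<close> is bounded by a
  multiple of \<open>\<parallel>x\<parallel>\<^sup>2 - \<parallel>T x\<parallel>\<^sup>2\<close> and by a multiple of \<open>\<parallel>x\<parallel>\<^sup>2 - \<parallel>T' x\<parallel>\<^sup>2\<close>, uniformly in \<open>x\<close>.

  Two values of a Schur function \<open>F\<close> are Pick equivalent by Harnack's inequality, applied to the functions
  \<open>z \<mapsto> \<langle>x, x\<rangle> - \<langle>F z x, A x\<rangle>\<close> with \<open>A\<close> a contraction, whose real part is nonnegative; by transitivity the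
  same holds for the end points of a Kobayashi chain. Pick equivalence gives
  \<open>\<bar>\<langle>(T' - T) x, y\<rangle>\<bar> \<le> K \<parallel>D\<^sub>T x\<parallel> \<parallel>D\<^sub>T\<^sub>* y\<parallel>\<close> by polarization, which is Shmul'yan domination by the Riesz
  theorem. Finally, if \<open>T' = T + D\<^sub>T\<^sub>* X D\<^sub>T\<close> and \<open>T'\<close> dominates \<open>T\<close>, then
  \<open>\<parallel>X D\<^sub>T x\<parallel> \<le> r \<parallel>(1 - T\<^sup>* X) D\<^sub>T x\<parallel>\<close> with \<open>r < 1\<close>, so that \<open>X D\<^sub>T = r W (1 - T\<^sup>* X) D\<^sub>T\<close> for a
  contraction \<open>W\<close>, and \<open>F z = T + z D\<^sub>T\<^sub>* W (1 + z T\<^sup>* W)\<^sup>-\<^sup>1 D\<^sub>T\<close> is a Schur function with \<open>F 0 = T\<close>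
  and \<open>F r = T'\<close>.\<close>

section \<open>Complex inner product spaces\<close>

instance complex_hilbert \<subseteq> banach ..

lemma cinner_add_right: "cinner x (y + z) = cinner x y + cinner x z"
  for x :: "'a :: complex_inner"
  by (metis cinner_add_left cinner_commute complex_cnj_add)

lemma cinner_scaleC_right: "cinner x (c *\<^sub>C y) = cnj c * cinner x y"
  for x :: "'a :: complex_inner"
  by (metis cinner_commute cinner_scaleC_left complex_cnj_mult)

lemma cinner_scaleR_left: "cinner (r *\<^sub>R x) y = r *\<^sub>R cinner x y"
  for x :: "'a :: complex_inner"
  by (simp add: scaleR_scaleC[of r x] cinner_scaleC_left scaleR_conv_of_real)

lemma cinner_scaleR_right: "cinner x (r *\<^sub>R y) = r *\<^sub>R cinner x y"
  for x :: "'a :: complex_inner"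
  by (simp add: scaleR_scaleC[of r y] cinner_scaleC_right scaleR_conv_of_real)

lemma Re_cinner_commute: "Re (cinner y x) = Re (cinner x y)"
  for x :: "'a :: complex_inner"
  by (subst cinner_commute) simp

lemma norm_add_sq: "(norm (x + y))\<^sup>2 = (norm x)\<^sup>2 + 2 * Re (cinner x y) + (norm y)\<^sup>2"
  for x :: "'a :: complex_inner"
proof -
  have "complex_of_real ((norm (x + y))\<^sup>2) = cinner (x + y) (x + y)"
    by (simp only: cinner_self)
  also have "\<dots> = cinner x x + cinner x y + cinner y x + cinner y y"
    by (simp add: cinner_add_left cinner_add_right)
  finally have "Re (complex_of_real ((norm (x + y))\<^sup>2))
      = Re (cinner x x + cinner x y + cinner y x + cinner y y)"
    by (rule arg_cong)
  then show ?thesis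
    by (simp add: cinner_self Re_cinner_commute[of y x])
qed

text \<open>Squaring the triangle inequality, which the norm satisfies by its class, bounds the real
  part of the inner product. Multiplying \<open>x\<close> by the phase \<open>c\<close> makes the
  inner product real and nonnegative.\<close>

lemma cinner_Cauchy_Schwarz: "cmod (cinner x y) \<le> norm x * norm y"
  for x :: "'a :: complex_inner"
proof -
  have *: "Re (cinner x y) \<le> norm x * norm y" for x y :: 'a
  proof -
    have "(norm (x + y))\<^sup>2 \<le> (norm x + norm y)\<^sup>2"
      by (intro power_mono norm_triangle_ineq) simp
    then show ?thesis
      by (simp add: norm_add_sq power2_sum)
  qed
  show ?thesis
  proof (cases "cinner x y = 0")
    case False
    define c where "c = cnj (cinner x y) / cmod (cinner x y)"
    have c: "cmod c = 1"
      using False by (simp add: c_def norm_divide)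
    have "cinner (c *\<^sub>C x) y = of_real (cmod (cinner x y))"
      using False complex_norm_square[of "cinner x y"]
      by (simp add: c_def cinner_scaleC_left field_simps power2_eq_square)
    then have "cmod (cinner x y) = Re (cinner (c *\<^sub>C x) y)"
      by simp
    also have "\<dots> \<le> norm (c *\<^sub>C x) * norm y"
      by (rule *)
    finally show ?thesis
      by (simp add: c norm_scaleC)
  qed simp
qed

interpretation cinner: bounded_bilinear "cinner :: 'a :: complex_inner \<Rightarrow> 'a \<Rightarrow> complex"
  by (rule bounded_bilinear.intro)
    (auto simp: cinner_add_left cinner_add_right cinner_scaleR_left cinner_scaleR_right
      intro!: exI[of _ 1] cinner_Cauchy_Schwarz)

lemma norm_diff_sq: "(norm (x - y))\<^sup>2 = (norm x)\<^sup>2 - 2 * Re (cinner x y) + (norm y)\<^sup>2"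
  for x :: "'a :: complex_inner"
  using norm_add_sq[of x "- y"] by (simp add: cinner.minus_right)

lemma cinner_ext: "(\<And>x. cinner x y = cinner x z) \<Longrightarrow> y = z"
  for y :: "'a :: complex_inner"
proof -
  assume "\<And>x. cinner x y = cinner x z"
  then have "cinner (y - z) (y - z) = 0"
    by (simp add: cinner.diff_right)
  then show ?thesis
    by (simp add: cinner_self)
qed

section \<open>Complex linear operators\<close>

lemma clinear_opD: "A \<in> clinear_op \<Longrightarrow> A (c *\<^sub>C x) = c *\<^sub>C A x"
  by (simp add: clinear_op_def)

lemma scaleC_zero_right [simp]: "c *\<^sub>C (0 :: 'a :: complex_vector) = 0"
  by (metis add_cancel_right_right scaleC_add_right)

lemma scaleC_minus_right: "c *\<^sub>C (- x) = - (c *\<^sub>C x)" for x :: "'a :: complex_vector"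
  by (metis add_eq_0_iff scaleC_add_right scaleC_zero_right add.right_inverse)

lemma scaleC_diff_right: "c *\<^sub>C (x - y) = c *\<^sub>C x - c *\<^sub>C y" for x :: "'a :: complex_vector"
  by (simp add: diff_conv_add_uminus scaleC_add_right scaleC_minus_right del: add_uminus_conv_diff)

lemma scaleC_zero_left [simp]: "0 *\<^sub>C (x :: 'a :: complex_vector) = 0"
  by (metis add_cancel_right_right scaleC_add_left)

lemma scaleC_minus_left: "(- c) *\<^sub>C x = - (c *\<^sub>C x)" for x :: "'a :: complex_vector"
  by (metis add.left_inverse scaleC_add_left eq_neg_iff_add_eq_0 scaleC_zero_left)

lemma scaleC_diff_left: "(c - d) *\<^sub>C x = c *\<^sub>C x - d *\<^sub>C x" for x :: "'a :: complex_vector"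
  by (simp add: diff_conv_add_uminus scaleC_add_left scaleC_minus_left del: add_uminus_conv_diff)

lemma clinear_op_add: "A \<in> clinear_op \<Longrightarrow> B \<in> clinear_op \<Longrightarrow> A + B \<in> clinear_op"
  by (simp add: clinear_op_def blinfun.add_left scaleC_add_right)

lemma clinear_op_diff: "A \<in> clinear_op \<Longrightarrow> B \<in> clinear_op \<Longrightarrow> A - B \<in> clinear_op"
  by (simp add: clinear_op_def blinfun.diff_left scaleC_diff_right)

lemma clinear_op_scaleC: "A \<in> clinear_op \<Longrightarrow> c *\<^sub>C A \<in> clinear_op"
  by (simp add: clinear_op_def scaleC_blinfun.rep_eq scaleC_scaleC mult.commute)

lemma clinear_op_scaleR: "A \<in> clinear_op \<Longrightarrow> r *\<^sub>R A \<in> clinear_op"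
  by (simp add: scaleR_scaleC clinear_op_scaleC)

lemma clinear_op_compose: "A \<in> clinear_op \<Longrightarrow> B \<in> clinear_op \<Longrightarrow> A o\<^sub>L B \<in> clinear_op"
  by (simp add: clinear_op_def)

lemma clinear_op_id: "id_blinfun \<in> clinear_op"
  by (simp add: clinear_op_def)

lemma clinear_op_zero: "0 \<in> clinear_op"
  by (simp add: clinear_op_def)

lemma clinear_op_limit:
  assumes "\<And>n. A n \<in> clinear_op" and "A \<longlonglongrightarrow> B"
  shows "B \<in> clinear_op"
proof -
  have "B (c *\<^sub>C x) = c *\<^sub>C B x" for c x
  proof (rule LIMSEQ_unique)
    show "(\<lambda>n. A n (c *\<^sub>C x)) \<longlonglongrightarrow> B (c *\<^sub>C x)"
      by (intro tendsto_intros assms)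
    have "(\<lambda>n. c *\<^sub>C A n x) \<longlonglongrightarrow> c *\<^sub>C B x"
      by (intro bounded_linear.tendsto[OF bounded_linear_scaleC_right] tendsto_intros assms)
    then show "(\<lambda>n. A n (c *\<^sub>C x)) \<longlonglongrightarrow> c *\<^sub>C B x"
      by (simp add: clinear_opD[OF assms(1)])
  qed
  then show ?thesis
    by (simp add: clinear_op_def)
qed

lemma clinear_opI:
  fixes h :: "'a :: complex_normed_vector \<Rightarrow> 'b :: complex_normed_vector"
  assumes "\<And>x y. h (x + y) = h x + h y" and "\<And>c x. h (c *\<^sub>C x) = c *\<^sub>C h x"
    and "\<And>x. norm (h x) \<le> K * norm x" and "0 \<le> K"
  shows "\<exists>H\<in>clinear_op. (\<forall>x. blinfun_apply H x = h x) \<and> norm H \<le> K"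
proof -
  have bl: "bounded_linear h"
    by (rule bounded_linear_intro[where K = K])
      (simp_all add: assms(1-3) scaleR_scaleC mult.commute[of _ K])
  show ?thesis
    using assms
    by (intro bexI[of _ "Blinfun h"])
      (auto simp: bounded_linear_Blinfun_apply[OF bl] clinear_op_def intro!: norm_blinfun_bound)
qed

section \<open>Riesz representation on the range of an operator\<close>

text \<open>A nonnegative quadratic that vanishes at \<open>0\<close> has derivative zero there. The
  test point is \<open>- b / (a + 1)\<close>; the added \<open>1\<close> covers
  \<open>a = 0\<close>.\<close>

lemma linear_coeff_zero:
  fixes a b :: real
  assumes "\<And>t. 0 \<le> t\<^sup>2 * a + t * b" and "0 \<le> a"
  shows "b = 0"
proof -
  define s where "s = a + 1"
  have s: "0 < s" "a = s - 1"
    using assms(2) by (auto simp: s_def)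
  have "0 \<le> (- b / s)\<^sup>2 * a + (- b / s) * b"
    by (rule assms)
  also have "\<dots> = - (b / s)\<^sup>2"
    using s(1) unfolding s(2) by (simp add: field_simps power2_eq_square)
  finally show ?thesis
    using s by simp
qed

text \<open>Direct method: along a minimizing sequence of \<open>J\<close> the vectors
  \<open>g (X n)\<close> are Cauchy, and the vanishing first variation identifies their limit
  \<open>z\<close>. Only \<open>g (X n)\<close> converges, not \<open>X n\<close>, so
  \<open>z\<close> lies in the closure of the range.\<close>

lemma riesz_range:
  fixes g :: "'c :: complex_normed_vector \<Rightarrow>\<^sub>L 'a :: complex_hilbert" and f :: "'c \<Rightarrow> complex"
  assumes g: "g \<in> clinear_op"
    and add: "\<And>x y. f (x + y) = f x + f y" and scale: "\<And>c x. f (c *\<^sub>C x) = c * f x"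
    and bound: "\<And>x. cmod (f x) \<le> M * norm (g x)" and M: "0 \<le> M"
  shows "\<exists>z\<in>closure (range g). norm z \<le> M \<and> (\<forall>x. f x = cinner (g x) z)"
proof -
  have scaleR: "f (r *\<^sub>R x) = r *\<^sub>R f x" for r x
    by (simp add: scaleR_scaleC[of r x] scale scaleR_conv_of_real)
  define J where "J x = (norm (g x))\<^sup>2 - 2 * Re (f x)" for x
  define m where "m = Inf (range J)"
  have "- M\<^sup>2 \<le> J x" for x
  proof -
    have "Re (f x) \<le> M * norm (g x)"
      using bound[of x] complex_Re_le_cmod[of "f x"] by linarith
    moreover have "0 \<le> (norm (g x) - M)\<^sup>2"
      by simp
    ultimately show ?thesis
      by (simp add: J_def power2_diff mult.commute)
  qed
  then have bdd: "bdd_below (range J)"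
    by (auto intro!: bdd_belowI[of _ "- M\<^sup>2"])
  have m_le: "m \<le> J x" for x
    unfolding m_def by (rule cINF_lower[OF bdd]) simp
  have "\<exists>x. J x < m + 1 / real (Suc n)" for n
    using cInf_lessD[of "range J" "m + 1 / real (Suc n)"] by (auto simp: m_def)
  then obtain X where X: "\<And>n. J (X n) < m + 1 / real (Suc n)"
    by metis
  have lim0: "(\<lambda>n. 1 / real (Suc n)) \<longlonglongrightarrow> 0"
    by (rule lim_1_over_n[THEN LIMSEQ_Suc])
  have JX: "(\<lambda>n. J (X n)) \<longlonglongrightarrow> m"
  proof (rule tendsto_sandwich[OF _ _ tendsto_const])
    show "(\<lambda>n. m + 1 / real (Suc n)) \<longlonglongrightarrow> m"
      using tendsto_add[OF tendsto_const lim0, of m] by simp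
  qed (use X[THEN less_imp_le] m_le in \<open>auto intro!: always_eventually\<close>)
  \<comment> \<open>The parallelogram law, with \<open>J\<close> at least \<open>m\<close> at the
    midpoint \<open>w\<close>.\<close>
  have para: "(norm (g x - g y))\<^sup>2 \<le> 2 * (J x - m) + 2 * (J y - m)" for x y
  proof -
    define w where "w = (1/2) *\<^sub>R (x + y)"
    have "(norm (g w))\<^sup>2 = (norm (g x + g y))\<^sup>2 / 4"
      by (simp add: w_def blinfun.scaleR_right blinfun.add_right power_divide)
    then have "(norm (g x - g y))\<^sup>2 = 2 * J x + 2 * J y - 4 * J w"
      unfolding J_def w_def scaleR add by (simp add: norm_add_sq norm_diff_sq field_simps)
    then show ?thesis
      using m_le[of w] by (simp add: algebra_simps)
  qed
  have "Cauchy (\<lambda>n. g (X n))"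
  proof (rule metric_CauchyI)
    fix e :: real
    assume e: "0 < e"
    have "\<forall>\<^sub>F n in sequentially. J (X n) < m + e\<^sup>2 / 4"
      using order_tendstoD(2)[OF JX, of "m + e\<^sup>2 / 4"] e by simp
    then obtain N where N: "\<And>n. N \<le> n \<Longrightarrow> J (X n) < m + e\<^sup>2 / 4"
      by (auto simp: eventually_sequentially)
    have "dist (g (X i)) (g (X j)) < e" if "N \<le> i" "N \<le> j" for i j
    proof -
      have "(norm (g (X i) - g (X j)))\<^sup>2 < e\<^sup>2"
        using para[of "X i" "X j"] N[OF that(1)] N[OF that(2)] by (simp add: field_simps)
      then show ?thesis
        using e by (simp add: dist_norm power2_less_imp_less)
    qed
    then show "\<exists>N. \<forall>i\<ge>N. \<forall>j\<ge>N. dist (g (X i)) (g (X j)) < e"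
      by blast
  qed
  then obtain z where z: "(\<lambda>n. g (X n)) \<longlonglongrightarrow> z"
    by (auto dest!: Cauchy_convergent simp: convergent_def)
  have z_closure: "z \<in> closure (range g)"
    unfolding closure_sequential using z by (intro exI[of _ "\<lambda>n. g (X n)"]) simp
  have Re_eq: "Re (f w) = Re (cinner (g w) z)" for w
  proof -
    \<comment> \<open>First variation of \<open>J\<close>: its value at
      \<open>X n + t *\<^sub>R w\<close> stays above \<open>m\<close>, and \<open>n\<close> tends to
      infinity.\<close>
    have "0 \<le> t\<^sup>2 * (norm (g w))\<^sup>2 + t * (2 * Re (cinner (g w) z) - 2 * Re (f w))" for t
    proof -
      have "J (X n + t *\<^sub>R w) = J (X n) + t\<^sup>2 * (norm (g w))\<^sup>2
          + t * (2 * Re (cinner (g w) (g (X n))) - 2 * Re (f w))" for n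
        unfolding J_def add scaleR blinfun.add_right blinfun.scaleR_right norm_add_sq
        by (simp add: cinner_scaleR_right Re_cinner_commute[of "g w"] power_mult_distrib algebra_simps)
      then have "m \<le> J (X n) + t\<^sup>2 * (norm (g w))\<^sup>2
          + t * (2 * Re (cinner (g w) (g (X n))) - 2 * Re (f w))" for n
        using m_le by metis
      moreover have "(\<lambda>n. J (X n) + t\<^sup>2 * (norm (g w))\<^sup>2
            + t * (2 * Re (cinner (g w) (g (X n))) - 2 * Re (f w)))
          \<longlonglongrightarrow> m + t\<^sup>2 * (norm (g w))\<^sup>2 + t * (2 * Re (cinner (g w) z) - 2 * Re (f w))"
        by (intro tendsto_intros JX cinner.tendsto z)
      ultimately have "m \<le> m + t\<^sup>2 * (norm (g w))\<^sup>2
          + t * (2 * Re (cinner (g w) z) - 2 * Re (f w))"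
        by (intro LIMSEQ_le_const[where a = m]) auto
      then show ?thesis
        by simp
    qed
    from linear_coeff_zero[OF this] show ?thesis
      by simp
  qed
  have f_eq: "f w = cinner (g w) z" for w
  proof (rule complex_eqI)
    show "Im (f w) = Im (cinner (g w) z)"
      using Re_eq[of "\<i> *\<^sub>C w"] by (simp add: scale clinear_opD[OF g] cinner_scaleC_left)
  qed (rule Re_eq)
  \<comment> \<open>The bound on \<open>f\<close> at \<open>X n\<close> passes to the limit and
    becomes a bound on \<open>norm z\<close> itself.\<close>
  have "cmod (cinner z z) \<le> M * norm z"
  proof (rule LIMSEQ_le)
    show "(\<lambda>n. cmod (cinner (g (X n)) z)) \<longlonglongrightarrow> cmod (cinner z z)"
      and "(\<lambda>n. M * norm (g (X n))) \<longlonglongrightarrow> M * norm z"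
      by (intro tendsto_intros cinner.tendsto z)+
  qed (use bound f_eq in auto)
  then have "norm z * norm z \<le> M * norm z"
    by (simp add: cinner_self norm_power power2_eq_square norm_mult)
  then have "norm z \<le> M"
    using M by (cases "norm z = 0") (auto simp: mult_le_cancel_right)
  with z_closure f_eq show ?thesis
    by blast
qed

text \<open>The vector \<open>z - w\<close> is orthogonal to the range, hence to its closure. The
  closure contains \<open>z\<close> and \<open>w\<close>, so \<open>z - w\<close> is orthogonal to
  itself.\<close>

lemma riesz_range_unique:
  fixes g :: "'c :: complex_normed_vector \<Rightarrow>\<^sub>L 'a :: complex_hilbert"
  assumes "z \<in> closure (range g)" and "w \<in> closure (range g)"
    and eq: "\<And>x. cinner (g x) z = cinner (g x) w"
  shows "z = w"
proof -
  have "closed {v. cinner v (z - w) = 0}"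
    by (intro closed_Collect_eq continuous_intros cinner.continuous_on)
  moreover have "range g \<subseteq> {v. cinner v (z - w) = 0}"
    using eq by (auto simp: cinner.diff_right)
  ultimately have "closure (range g) \<subseteq> {v. cinner v (z - w) = 0}"
    by (simp add: closure_minimal)
  then have "cinner z (z - w) = 0" "cinner w (z - w) = 0"
    using assms by auto
  then have "cinner (z - w) (z - w) = 0"
    by (simp add: cinner.diff_left)
  then show ?thesis
    by (simp add: cinner_self)
qed

lemma closure_range_subspace:
  fixes g :: "'c :: complex_normed_vector \<Rightarrow>\<^sub>L 'a :: complex_normed_vector"
  assumes "g \<in> clinear_op" and "v \<in> closure (range g)" "w \<in> closure (range g)"
  shows "v + w \<in> closure (range g)" and "c *\<^sub>C v \<in> closure (range g)"
proof -
  obtain V W where VW: "\<And>n. V n \<in> range g" "V \<longlonglongrightarrow> v" "\<And>n. W n \<in> range g" "W \<longlonglongrightarrow> w"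
    using assms by (auto simp: closure_sequential)
  have "V n + W n \<in> range g" for n
    using VW(1)[of n] VW(3)[of n] by (auto simp: blinfun.add_right[symmetric])
  moreover have "(\<lambda>n. V n + W n) \<longlonglongrightarrow> v + w"
    by (intro tendsto_add VW)
  ultimately show "v + w \<in> closure (range g)"
    unfolding closure_sequential by (intro exI[of _ "\<lambda>n. V n + W n"]) simp
  have "c *\<^sub>C V n \<in> range g" for n
    using VW(1)[of n] by (auto simp: clinear_opD[OF assms(1), symmetric])
  moreover have "(\<lambda>n. c *\<^sub>C V n) \<longlonglongrightarrow> c *\<^sub>C v"
    by (intro VW bounded_linear.tendsto[OF bounded_linear_scaleC_right])
  ultimately show "c *\<^sub>C v \<in> closure (range g)"
    unfolding closure_sequential by (intro exI[of _ "\<lambda>n. c *\<^sub>C V n"]) simp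
qed

text \<open>Uniqueness inside the closure makes the Riesz vectors linear in \<open>d\<close>, since
  the functionals are conjugate linear in \<open>d\<close>. \<open>N\<close> records a pointwise
  bound finer than \<open>K * norm d\<close>; the domination proof needs it.\<close>

lemma riesz_range_family:
  fixes g :: "'c :: complex_normed_vector \<Rightarrow>\<^sub>L 'a :: complex_hilbert"
    and f :: "'d :: complex_normed_vector \<Rightarrow> 'c \<Rightarrow> complex"
  assumes g: "g \<in> clinear_op"
    and add: "\<And>d x y. f d (x + y) = f d x + f d y"
    and scale: "\<And>d c x. f d (c *\<^sub>C x) = c * f d x"
    and add': "\<And>d e x. f (d + e) x = f d x + f e x"
    and scale': "\<And>d c x. f (c *\<^sub>C d) x = cnj c * f d x"
    and bound: "\<And>d x. cmod (f d x) \<le> N d * norm (g x)"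
    and N: "\<And>d. 0 \<le> N d" "\<And>d. N d \<le> K * norm d" and K: "0 \<le> K"
  shows "\<exists>h\<in>clinear_op. norm h \<le> K \<and> (\<forall>d. blinfun_apply h d \<in> closure (range g)
    \<and> norm (h d) \<le> N d \<and> (\<forall>x. f d x = cinner (g x) (h d)))"
proof -
  have "\<exists>z\<in>closure (range g). norm z \<le> N d \<and> (\<forall>x. f d x = cinner (g x) z)" for d
    by (rule riesz_range[OF g add scale bound N(1)])
  then obtain h where h: "\<And>d. h d \<in> closure (range g)" "\<And>d. norm (h d) \<le> N d"
      "\<And>d x. f d x = cinner (g x) (h d)"
    by metis
  have "h (d + e) = h d + h e" for d e
    by (rule riesz_range_unique[of _ g])
      (simp_all add: h(1) closure_range_subspace[OF g] add' cinner_add_right flip: h(3))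
  moreover have "h (c *\<^sub>C d) = c *\<^sub>C h d" for c d
    by (rule riesz_range_unique[of _ g])
      (simp_all add: h(1) closure_range_subspace(2)[OF g h(1) h(1)] scale' cinner_scaleC_right flip: h(3))
  moreover have "norm (h d) \<le> K * norm d" for d
    using h(2) N(2) order_trans by blast
  ultimately obtain H where "H \<in> clinear_op" "\<forall>d. blinfun_apply H d = h d" "norm H \<le> K"
    using clinear_opI[of h K] K by blast
  with h show ?thesis
    by (intro bexI[of _ H]) auto
qed

section \<open>Adjoints and Douglas factorization\<close>

lemma adjoint_exists:
  fixes A :: "'a :: complex_hilbert \<Rightarrow>\<^sub>L 'b :: complex_hilbert"
  assumes A: "A \<in> clinear_op"
  shows "\<exists>B\<in>clinear_op. norm B \<le> norm A \<and> (\<forall>x y. cinner (A x) y = cinner x (blinfun_apply B y))"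
proof -
  have "cmod (cinner (A x) d) \<le> (norm A * norm d) * norm (id_blinfun x)" for d x
  proof -
    have "cmod (cinner (A x) d) \<le> norm (A x) * norm d"
      by (rule cinner_Cauchy_Schwarz)
    also have "\<dots> \<le> (norm A * norm x) * norm d"
      by (intro mult_right_mono norm_blinfun) simp
    finally show ?thesis
      by (simp add: mult_ac)
  qed
  then have "\<exists>h\<in>clinear_op. norm h \<le> norm A \<and> (\<forall>d. blinfun_apply h d \<in> closure (range id_blinfun)
    \<and> norm (h d) \<le> norm A * norm d \<and> (\<forall>x. cinner (A x) d = cinner (id_blinfun x) (h d)))"
    by (intro riesz_range_family)
      (auto simp: clinear_op_id blinfun.add_right cinner_add_left clinear_opD[OF A] cinner_scaleC_left
        cinner_add_right cinner_scaleC_right)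
  then show ?thesis
    by auto
qed

lemma adjoint_op:
  fixes A :: "'a :: complex_hilbert \<Rightarrow>\<^sub>L 'b :: complex_hilbert"
  assumes "A \<in> clinear_op"
  shows adjoint_op_clinear: "adjoint_op A \<in> clinear_op"
    and cinner_adjoint_op: "cinner (A x) y = cinner x (adjoint_op A y)"
    and norm_adjoint_op_le: "norm (adjoint_op A) \<le> norm A"
proof -
  obtain B where B: "B \<in> clinear_op" "norm B \<le> norm A"
      "\<And>x y. cinner (A x) y = cinner x (blinfun_apply B y)"
    using adjoint_exists[OF assms] by metis
  have "adjoint_op A = B"
    unfolding adjoint_op_def
  proof (rule the_equality)
    fix C
    assume "C \<in> clinear_op \<and> (\<forall>x y. cinner (A x) y = cinner x (blinfun_apply C y))"
    then have "C y = B y" for y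
      using B(3) by (metis cinner_ext)
    then show "C = B"
      by (rule blinfun_eqI)
  qed (use B in blast)
  with B show "adjoint_op A \<in> clinear_op" "cinner (A x) y = cinner x (adjoint_op A y)"
    "norm (adjoint_op A) \<le> norm A"
    by auto
qed

lemma cinner_adjoint_op_left:
  assumes "A \<in> clinear_op"
  shows "cinner (adjoint_op A y) x = cinner y (A x)"
  by (subst cinner_commute, subst (2) cinner_commute) (simp only: cinner_adjoint_op[OF assms])

lemma adjoint_op_adjoint_op:
  assumes "A \<in> clinear_op"
  shows "adjoint_op (adjoint_op A) = A"
proof (rule blinfun_eqI, rule cinner_ext)
  show "cinner y (adjoint_op (adjoint_op A) x) = cinner y (A x)" for x y
    by (rule trans[OF cinner_adjoint_op[OF adjoint_op_clinear[OF assms], symmetric]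
      cinner_adjoint_op_left[OF assms]])
qed

lemma contractionsD:
  assumes "A \<in> contractions"
  shows "A \<in> clinear_op" and "norm A \<le> 1" and "norm (A x) \<le> norm x"
proof -
  show "A \<in> clinear_op" and "norm A \<le> 1"
    using assms by (auto simp: contractions_def)
  then show "norm (A x) \<le> norm x"
    using norm_blinfun[of A x] mult_right_mono[of "norm A" 1 "norm x"] by simp
qed

lemma adjoint_op_contractions: "A \<in> contractions \<Longrightarrow> adjoint_op A \<in> contractions"
  by (auto simp: contractions_def adjoint_op_clinear intro: order_trans[OF norm_adjoint_op_le])

text \<open>The Riesz vectors, relative to \<open>g\<close>, of the functionals sending
  \<open>x\<close> to \<open>cinner (h x) d\<close> form an operator \<open>Z\<close>, and
  \<open>Y\<close> is its adjoint. Taking the adjoint defines \<open>Y\<close> on the whole space,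
  while \<open>h\<close> determines it only on the closure of the range of \<open>g\<close>.\<close>

lemma douglas_factorization:
  fixes g :: "'c :: complex_normed_vector \<Rightarrow>\<^sub>L 'a :: complex_hilbert"
    and h :: "'c \<Rightarrow>\<^sub>L 'b :: complex_hilbert"
  assumes g: "g \<in> clinear_op" and h: "h \<in> clinear_op"
    and bound: "\<And>x. norm (h x) \<le> K * norm (g x)" and K: "0 \<le> K"
  shows "\<exists>Y\<in>clinear_op. norm Y \<le> K \<and> (\<forall>x. h x = blinfun_apply Y (g x))"
proof -
  have "cmod (cinner (h x) d) \<le> (K * norm d) * norm (g x)" for d x
  proof -
    have "cmod (cinner (h x) d) \<le> norm (h x) * norm d"
      by (rule cinner_Cauchy_Schwarz)
    also have "\<dots> \<le> (K * norm (g x)) * norm d"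
      by (intro mult_right_mono bound) simp
    finally show ?thesis
      by (simp add: mult_ac)
  qed
  then have "\<exists>Z\<in>clinear_op. norm Z \<le> K \<and> (\<forall>d. blinfun_apply Z d \<in> closure (range g)
    \<and> norm (Z d) \<le> K * norm d \<and> (\<forall>x. cinner (h x) d = cinner (g x) (Z d)))"
    by (intro riesz_range_family)
      (auto simp: g K blinfun.add_right cinner_add_left clinear_opD[OF h] cinner_scaleC_left
        cinner_add_right cinner_scaleC_right)
  then obtain Z where Z: "Z \<in> clinear_op" "norm Z \<le> K"
      "\<And>x d. cinner (h x) d = cinner (g x) (blinfun_apply Z d)"
    by blast
  have "h x = adjoint_op Z (g x)" for x
    by (rule cinner_ext) (metis Z(1,3) cinner_adjoint_op cinner_commute)
  with Z(1,2) show ?thesis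
    by (intro bexI[of _ "adjoint_op Z"])
      (auto intro: adjoint_op_clinear order_trans[OF norm_adjoint_op_le])
qed

section \<open>Square roots and defect operators\<close>

text \<open>Iteration for \<open>Y = (B + Y Y) / 2\<close>, which is equivalent to
  \<open>(1 - Y) (1 - Y) = 1 - B\<close>; the limit therefore gives a square root of
  \<open>1 - B\<close>.\<close>

primrec sqrt_iter :: "('a :: complex_hilbert \<Rightarrow>\<^sub>L 'a) \<Rightarrow> nat \<Rightarrow> 'a \<Rightarrow>\<^sub>L 'a"
  where
    "sqrt_iter B 0 = 0"
  | "sqrt_iter B (Suc n) = (1/2) *\<^sub>R (B + (sqrt_iter B n o\<^sub>L sqrt_iter B n))"

primrec sqrt_iter_bound :: "nat \<Rightarrow> real"
  where
    "sqrt_iter_bound 0 = 0"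
  | "sqrt_iter_bound (Suc n) = (1 + (sqrt_iter_bound n)\<^sup>2) / 2"

lemma sqrt_iter_bound: "0 \<le> sqrt_iter_bound n \<and> sqrt_iter_bound n \<le> 1"
proof (induction n)
  case (Suc n)
  then show ?case
    using power_le_one[of "sqrt_iter_bound n" 2] by simp
qed auto

lemma incseq_sqrt_iter_bound: "incseq sqrt_iter_bound"
proof (rule incseq_SucI)
  show "sqrt_iter_bound n \<le> sqrt_iter_bound (Suc n)" for n
    using zero_le_power2[of "sqrt_iter_bound n - 1"] by (simp add: power2_diff)
qed

text \<open>The iterates are polynomials in \<open>B\<close> with nonnegative coefficients, and so are their
  differences; hence the scalar iteration at \<open>B = 1\<close> dominates the operator iteration in norm.\<close>

lemma norm_sqrt_iter:
  assumes "norm B \<le> 1"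
  shows "norm (sqrt_iter B n) \<le> sqrt_iter_bound n"
proof (induction n)
  case (Suc n)
  have "norm (sqrt_iter B n o\<^sub>L sqrt_iter B n) \<le> norm (sqrt_iter B n) * norm (sqrt_iter B n)"
    by (rule norm_blinfun_compose)
  also have "\<dots> \<le> sqrt_iter_bound n * sqrt_iter_bound n"
    by (intro mult_mono Suc) (simp_all add: sqrt_iter_bound)
  finally have "norm (B + (sqrt_iter B n o\<^sub>L sqrt_iter B n)) \<le> 1 + (sqrt_iter_bound n)\<^sup>2"
    unfolding power2_eq_square using assms by (intro norm_triangle_le add_mono)
  then show ?case
    by simp
qed simp

lemma norm_sqrt_iter_Suc_diff:
  assumes "norm B \<le> 1"
  shows "norm (sqrt_iter B (Suc n) - sqrt_iter B n) \<le> sqrt_iter_bound (Suc n) - sqrt_iter_bound n"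
proof (induction n)
  case 0
  then show ?case
    using assms by simp
next
  case (Suc n)
  define Y Z y z where "Y = sqrt_iter B (Suc n)" and "Z = sqrt_iter B n"
    and "y = sqrt_iter_bound (Suc n)" and "z = sqrt_iter_bound n"
  have IH: "norm (Y - Z) \<le> y - z"
    using Suc unfolding Y_def Z_def y_def z_def .
  have Y: "norm Y \<le> y" and Z: "norm Z \<le> z" and nonneg: "0 \<le> y" "0 \<le> z"
    using norm_sqrt_iter[OF assms] sqrt_iter_bound unfolding Y_def Z_def y_def z_def by blast+
  have "sqrt_iter B (Suc (Suc n)) - sqrt_iter B (Suc n)
      = (1/2) *\<^sub>R (B + (Y o\<^sub>L Y)) - (1/2) *\<^sub>R (B + (Z o\<^sub>L Z))"
    by (simp add: Y_def Z_def)
  \<comment> \<open>A difference of squares, split in the form valid for noncommuting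
    operators.\<close>
  also have "\<dots> = (1/2) *\<^sub>R ((Y o\<^sub>L (Y - Z)) + ((Y - Z) o\<^sub>L Z))"
    by (rule blinfun_eqI)
      (simp add: blinfun.add_left blinfun.diff_left blinfun.diff_right blinfun.scaleR_left
        scaleR_add_right scaleR_diff_right)
  also have "norm \<dots> \<le> (y * (y - z) + (y - z) * z) / 2"
  proof -
    have "norm (Y o\<^sub>L (Y - Z)) \<le> y * (y - z)"
      by (rule order_trans[OF norm_blinfun_compose]) (intro mult_mono Y IH nonneg norm_ge_zero)
    moreover have "norm ((Y - Z) o\<^sub>L Z) \<le> (y - z) * z"
      using order_trans[OF norm_ge_zero IH]
      by (intro order_trans[OF norm_blinfun_compose] mult_mono Z IH norm_ge_zero)
    ultimately have "norm ((Y o\<^sub>L (Y - Z)) + ((Y - Z) o\<^sub>L Z)) \<le> y * (y - z) + (y - z) * z"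
      by (intro norm_triangle_le add_mono)
    then show ?thesis
      by simp
  qed
  also have "\<dots> = (1 + y\<^sup>2) / 2 - (1 + z\<^sup>2) / 2"
    by (simp add: field_simps power2_eq_square)
  also have "\<dots> = sqrt_iter_bound (Suc (Suc n)) - sqrt_iter_bound (Suc n)"
    by (simp add: y_def z_def)
  finally show ?case .
qed

text \<open>By telescoping, increments are dominated by those of the bounded increasing scalar
  sequence. This reaches \<open>norm B = 1\<close>, where the iteration need not be a strict
  contraction and which defect operators require.\<close>

lemma convergent_sqrt_iter:
  assumes "norm B \<le> 1"
  shows "convergent (sqrt_iter B)"
proof -
  have le: "norm (sqrt_iter B (n + k) - sqrt_iter B n) \<le> sqrt_iter_bound (n + k) - sqrt_iter_bound n"
    for n k
  proof (induction k)
    case (Suc k)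
    have "norm (sqrt_iter B (n + Suc k) - sqrt_iter B n)
      \<le> norm (sqrt_iter B (Suc (n + k)) - sqrt_iter B (n + k)) + norm (sqrt_iter B (n + k) - sqrt_iter B n)"
      using norm_triangle_ineq[of "sqrt_iter B (Suc (n + k)) - sqrt_iter B (n + k)"
          "sqrt_iter B (n + k) - sqrt_iter B n"]
      by (simp del: sqrt_iter.simps)
    then show ?case
      using Suc norm_sqrt_iter_Suc_diff[OF assms, of "n + k"]
      by (simp del: sqrt_iter.simps sqrt_iter_bound.simps)
  qed simp
  obtain l where "sqrt_iter_bound \<longlonglongrightarrow> l"
    using incseq_convergent[OF incseq_sqrt_iter_bound, of 1] sqrt_iter_bound by blast
  then have "Cauchy sqrt_iter_bound"
    by (rule LIMSEQ_imp_Cauchy)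
  have "Cauchy (sqrt_iter B)"
  proof (rule metric_CauchyI)
    fix e :: real
    assume "0 < e"
    then obtain N where N: "\<And>m n. N \<le> m \<Longrightarrow> N \<le> n \<Longrightarrow> dist (sqrt_iter_bound m) (sqrt_iter_bound n) < e"
      using metric_CauchyD[OF \<open>Cauchy sqrt_iter_bound\<close>] by blast
    have less: "norm (sqrt_iter B m - sqrt_iter B n) < e" if "N \<le> n" "n \<le> m" for m n
      using le[of n "m - n"] N[of m n] that by (simp add: dist_real_def)
    have "dist (sqrt_iter B m) (sqrt_iter B n) < e" if "N \<le> m" "N \<le> n" for m n
      using less[of n m] less[of m n] that
      by (cases "n \<le> m") (auto simp: dist_norm norm_minus_commute)
    then show "\<exists>N. \<forall>m\<ge>N. \<forall>n\<ge>N. dist (sqrt_iter B m) (sqrt_iter B n) < e"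
      by blast
  qed
  then show ?thesis
    by (rule Cauchy_convergent)
qed

definition sqrt_limit :: "('a :: complex_hilbert \<Rightarrow>\<^sub>L 'a) \<Rightarrow> 'a \<Rightarrow>\<^sub>L 'a"
  where "sqrt_limit B = lim (sqrt_iter B)"

lemma sqrt_iter_LIMSEQ: "norm B \<le> 1 \<Longrightarrow> sqrt_iter B \<longlonglongrightarrow> sqrt_limit B"
  unfolding sqrt_limit_def using convergent_sqrt_iter convergent_LIMSEQ_iff by blast

lemma sqrt_limit_eq:
  assumes "norm B \<le> 1"
  shows "sqrt_limit B x = (1/2) *\<^sub>R (B x + sqrt_limit B (sqrt_limit B x))"
proof (rule LIMSEQ_unique)
  have lim: "(\<lambda>n. sqrt_iter B n x) \<longlonglongrightarrow> sqrt_limit B x" for x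
    by (intro blinfun.tendsto sqrt_iter_LIMSEQ assms tendsto_const)
  show "(\<lambda>n. sqrt_iter B (Suc n) x) \<longlonglongrightarrow> sqrt_limit B x"
    by (rule LIMSEQ_Suc[OF lim])
  have "(\<lambda>n. (1/2) *\<^sub>R (B x + sqrt_iter B n (sqrt_iter B n x)))
      \<longlonglongrightarrow> (1/2) *\<^sub>R (B x + sqrt_limit B (sqrt_limit B x))"
    by (intro tendsto_scaleR tendsto_add tendsto_const blinfun.tendsto sqrt_iter_LIMSEQ assms)
  then show "(\<lambda>n. sqrt_iter B (Suc n) x) \<longlonglongrightarrow> (1/2) *\<^sub>R (B x + sqrt_limit B (sqrt_limit B x))"
    by (simp add: blinfun.scaleR_left blinfun.add_left)
qed

lemma norm_sqrt_limit:
  assumes "norm B \<le> 1"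
  shows "norm (sqrt_limit B) \<le> 1"
proof (rule LIMSEQ_le_const2[OF tendsto_norm[OF sqrt_iter_LIMSEQ[OF assms]]])
  show "\<exists>N. \<forall>n\<ge>N. norm (sqrt_iter B n) \<le> 1"
    using norm_sqrt_iter[OF assms] sqrt_iter_bound order_trans by blast
qed

lemma clinear_sqrt_limit:
  assumes "B \<in> clinear_op" and "norm B \<le> 1"
  shows "sqrt_limit B \<in> clinear_op"
proof (rule clinear_op_limit[OF _ sqrt_iter_LIMSEQ[OF assms(2)]])
  show "sqrt_iter B n \<in> clinear_op" for n
    by (induction n)
      (simp_all add: clinear_op_zero clinear_op_scaleR clinear_op_add clinear_op_compose assms(1))
qed

text \<open>The relation passes to every iterate and then to the limit. Taking \<open>C = T\<close>
  will intertwine the two defect operators of \<open>T\<close>; taking \<open>C\<close> to be a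
  square root of \<open>1 - B\<close> will give commutation.\<close>

lemma sqrt_limit_intertwines:
  fixes B :: "'a :: complex_hilbert \<Rightarrow>\<^sub>L 'a" and B' :: "'b :: complex_hilbert \<Rightarrow>\<^sub>L 'b"
    and C :: "'a \<Rightarrow>\<^sub>L 'b"
  assumes "norm B \<le> 1" and "norm B' \<le> 1" and eq: "\<And>x. C (B x) = B' (C x)"
  shows "C (sqrt_limit B x) = sqrt_limit B' (C x)"
proof (rule LIMSEQ_unique)
  have "C (sqrt_iter B n x) = sqrt_iter B' n (C x)" for n x
    by (induction n arbitrary: x)
      (simp_all add: blinfun.scaleR_left blinfun.add_left blinfun.scaleR_right blinfun.add_right eq)
  moreover show "(\<lambda>n. C (sqrt_iter B n x)) \<longlonglongrightarrow> C (sqrt_limit B x)"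
    by (intro blinfun.tendsto sqrt_iter_LIMSEQ assms tendsto_const)
  moreover have "(\<lambda>n. sqrt_iter B' n (C x)) \<longlonglongrightarrow> sqrt_limit B' (C x)"
    by (intro blinfun.tendsto sqrt_iter_LIMSEQ assms tendsto_const)
  ultimately show "(\<lambda>n. C (sqrt_iter B n x)) \<longlonglongrightarrow> sqrt_limit B' (C x)"
    by simp
qed

lemma sqrt_limit_hermitian:
  fixes B :: "'a :: complex_hilbert \<Rightarrow>\<^sub>L 'a"
  assumes "norm B \<le> 1" and herm: "\<And>x y. cinner (B x) y = cinner x (B y)"
  shows "cinner (sqrt_limit B x) y = cinner x (sqrt_limit B y)"
proof (rule LIMSEQ_unique)
  have "cinner (sqrt_iter B n x) y = cinner x (sqrt_iter B n y)" for n x y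
    by (induction n arbitrary: x y)
      (simp_all add: blinfun.scaleR_left blinfun.add_left cinner_scaleR_left cinner_scaleR_right
        cinner_add_left cinner_add_right cinner.zero_left cinner.zero_right herm)
  moreover show "(\<lambda>n. cinner (sqrt_iter B n x) y) \<longlonglongrightarrow> cinner (sqrt_limit B x) y"
    by (intro blinfun.tendsto cinner.tendsto sqrt_iter_LIMSEQ assms tendsto_const)
  moreover have "(\<lambda>n. cinner x (sqrt_iter B n y)) \<longlonglongrightarrow> cinner x (sqrt_limit B y)"
    by (intro blinfun.tendsto cinner.tendsto sqrt_iter_LIMSEQ assms tendsto_const)
  ultimately show "(\<lambda>n. cinner (sqrt_iter B n x) y) \<longlonglongrightarrow> cinner x (sqrt_limit B y)"
    by simp
qed

text \<open>A sesquilinear form with real diagonal is Hermitian; this is read off from the diagonal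
  at \<open>x + y\<close> and at \<open>x + \<i> *\<^sub>C y\<close>.\<close>

lemma positive_op_hermitian:
  assumes "positive_op P"
  shows "cinner (P x) y = cinner x (P y)"
proof -
  have P: "P \<in> clinear_op" and Im0: "Im (cinner (P x) x) = 0" for x
    using assms by (auto simp: positive_op_def complex_nonneg_Reals_iff)
  have 1: "Im (cinner (P x) y) + Im (cinner (P y) x) = 0"
    using Im0[of "x + y"] Im0[of x] Im0[of y]
    by (simp add: blinfun.add_right cinner_add_left cinner_add_right)
  have 2: "Re (cinner (P y) x) - Re (cinner (P x) y) = 0"
    using Im0[of "x + \<i> *\<^sub>C y"] Im0[of x] Im0[of y]
    by (simp add: blinfun.add_right cinner_add_left cinner_add_right clinear_opD[OF P]
        cinner_scaleC_left cinner_scaleC_right)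
  have "cinner (P x) y = cnj (cinner (P y) x)"
    using 1 2 by (intro complex_eqI) simp_all
  also have "\<dots> = cinner x (P y)"
    by (rule cinner_commute[symmetric])
  finally show ?thesis .
qed

text \<open>Along \<open>x + t *\<^sub>R P x\<close> the form is minimal at \<open>t = 0\<close>,
  and its linear coefficient there is twice the square of \<open>norm (P x)\<close>.\<close>

lemma positive_op_kernel:
  assumes P: "positive_op P" and "cinner (P x) x = 0"
  shows "P x = 0"
proof -
  have nonneg: "0 \<le> Re (cinner (P y) y)" for y
    using P by (auto simp: positive_op_def complex_nonneg_Reals_iff)
  have "0 \<le> t\<^sup>2 * Re (cinner (P (P x)) (P x)) + t * (2 * (norm (P x))\<^sup>2)" for t
  proof -
    have "cinner (P (P x)) x = cinner (P x) (P x)"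
      by (rule positive_op_hermitian[OF P])
    then have "Re (cinner (P (x + t *\<^sub>R P x)) (x + t *\<^sub>R P x))
        = t\<^sup>2 * Re (cinner (P (P x)) (P x)) + t * (2 * (norm (P x))\<^sup>2)"
      using assms(2)
      by (simp add: blinfun.add_right blinfun.scaleR_right cinner_add_left cinner_add_right
          cinner_scaleR_left cinner_scaleR_right cinner_self power2_eq_square algebra_simps)
    then show ?thesis
      using nonneg[of "x + t *\<^sub>R P x"] by simp
  qed
  from linear_coeff_zero[OF this nonneg] show ?thesis
    by simp
qed

text \<open>Uniqueness: another positive root \<open>Q\<close> commutes with \<open>B\<close>, hence
  with \<open>R\<close>, so \<open>(Q + R) (Q - R) = 0\<close>. Positivity then puts the range of
  \<open>Q - R\<close> into the kernels of \<open>Q\<close> and \<open>R\<close>, and since both are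
  Hermitian that range is orthogonal to itself.\<close>

lemma sqrt_op_eq:
  fixes B :: "'a :: complex_hilbert \<Rightarrow>\<^sub>L 'a"
  assumes B: "B \<in> clinear_op" "norm B \<le> 1" and herm: "\<And>x y. cinner (B x) y = cinner x (B y)"
  defines "R \<equiv> id_blinfun - sqrt_limit B"
  shows "positive_op R" and "R o\<^sub>L R = id_blinfun - B" and "sqrt_op (id_blinfun - B) = R"
proof -
  have R: "R x = x - sqrt_limit B x" for x
    by (simp add: R_def blinfun.diff_left)
  have R_herm: "cinner (R x) y = cinner x (R y)" for x y
    by (simp add: R cinner.diff_left cinner.diff_right sqrt_limit_hermitian[OF B(2) herm])
  have R_clinear: "R \<in> clinear_op"
    unfolding R_def by (intro clinear_op_diff clinear_op_id clinear_sqrt_limit B)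
  show pos: "positive_op R"
  proof -
    have "cinner (R x) x \<in> \<real>\<^sub>\<ge>\<^sub>0" for x
    proof -
      have "cinner (R x) x = cnj (cinner (R x) x)"
        by (subst R_herm) (rule cinner_commute)
      then have "Im (cinner (R x) x) = 0"
        by (metis Reals_cnj_iff complex_is_Real_iff)
      moreover have "Re (cinner (sqrt_limit B x) x) \<le> (norm x)\<^sup>2"
      proof -
        have "Re (cinner (sqrt_limit B x) x) \<le> norm (sqrt_limit B x) * norm x"
          using complex_Re_le_cmod cinner_Cauchy_Schwarz order_trans by blast
        also have "\<dots> \<le> (norm (sqrt_limit B) * norm x) * norm x"
          by (intro mult_right_mono norm_blinfun norm_ge_zero)
        also have "\<dots> \<le> (1 * norm x) * norm x"
          by (intro mult_right_mono norm_sqrt_limit B norm_ge_zero)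
        finally show ?thesis
          by (simp add: power2_eq_square)
      qed
      then have "0 \<le> Re (cinner (R x) x)"
        by (simp add: R cinner.diff_left cinner_self)
      ultimately show ?thesis
        by (simp add: complex_nonneg_Reals_iff)
    qed
    with R_clinear show ?thesis
      by (simp add: positive_op_def)
  qed
  show sq: "R o\<^sub>L R = id_blinfun - B"
  proof (rule blinfun_eqI)
    fix x
    have "sqrt_limit B (sqrt_limit B x) = 2 *\<^sub>R sqrt_limit B x - B x"
      by (subst (3) sqrt_limit_eq[OF B(2)]) simp
    then show "(R o\<^sub>L R) x = (id_blinfun - B) x"
      by (simp add: R blinfun.diff_left blinfun.diff_right scaleR_2)
  qed
  show "sqrt_op (id_blinfun - B) = R"
    unfolding sqrt_op_def
  proof (rule the_equality)
    fix Q
    assume Q: "positive_op Q \<and> Q o\<^sub>L Q = id_blinfun - B"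
    have QQ: "Q (Q x) = x - B x" and RR: "R (R x) = x - B x" for x
      using Q sq by (metis blinfun_apply_blinfun_compose blinfun.diff_left blinfun_apply_id_blinfun)+
    \<comment> \<open>Fact \<open>QQ\<close> computes the cube of \<open>Q\<close> in two
      ways.\<close>
    have "Q (B x) = B (Q x)" for x
    proof -
      have "Q (x - B x) = Q x - B (Q x)"
        by (metis QQ)
      then show ?thesis
        by (simp add: blinfun.diff_right)
    qed
    then have QR: "Q (R x) = R (Q x)" for x
      by (simp add: R blinfun.diff_right sqrt_limit_intertwines[OF B(2) B(2)])
    have "Q x = R x" for x
    proof -
      define y where "y = Q x - R x"
      have "Q y + R y = 0"
        by (simp add: y_def blinfun.diff_right QQ RR QR)
      then have "cinner (Q y) y + cinner (R y) y = 0"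
        by (metis cinner_add_left cinner.zero_left)
      moreover have "cinner (Q y) y \<in> \<real>\<^sub>\<ge>\<^sub>0" "cinner (R y) y \<in> \<real>\<^sub>\<ge>\<^sub>0"
        using Q pos by (auto simp: positive_op_def)
      ultimately have "cinner (Q y) y = 0" "cinner (R y) y = 0"
        by (auto simp: complex_nonneg_Reals_iff complex_eq_iff)
      then have "Q y = 0" "R y = 0"
        using positive_op_kernel Q pos by blast+
      then have "cinner (Q x) y = 0" "cinner (R x) y = 0"
        using positive_op_hermitian[of Q x y] R_herm[of x y] Q by (simp_all add: cinner.zero_right)
      then have "cinner y y = 0"
        by (subst (1) y_def) (simp add: cinner.diff_left)
      then show ?thesis
        by (simp add: cinner_self y_def)
    qed
    then show "Q = R"
      by (rule blinfun_eqI)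
  qed (use pos sq in blast)
qed

section \<open>Defect operators\<close>

lemma defect_op_sqrt_limit:
  fixes T :: "'a :: complex_hilbert \<Rightarrow>\<^sub>L 'b :: complex_hilbert"
  assumes T: "T \<in> contractions"
  shows "norm (adjoint_op T o\<^sub>L T) \<le> 1" and "positive_op (defect_op T)"
    and "defect_op T o\<^sub>L defect_op T = id_blinfun - (adjoint_op T o\<^sub>L T)"
    and "defect_op T = id_blinfun - sqrt_limit (adjoint_op T o\<^sub>L T)"
proof -
  have lin: "adjoint_op T o\<^sub>L T \<in> clinear_op"
    using T by (intro clinear_op_compose adjoint_op_clinear contractionsD)
  have "norm (adjoint_op T o\<^sub>L T) \<le> norm (adjoint_op T) * norm T"
    by (rule norm_blinfun_compose)
  also have "\<dots> \<le> 1 * 1"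
    using T by (intro mult_mono contractionsD adjoint_op_contractions) auto
  finally show norm: "norm (adjoint_op T o\<^sub>L T) \<le> 1"
    by simp
  have "cinner ((adjoint_op T o\<^sub>L T) x) y = cinner x ((adjoint_op T o\<^sub>L T) y)" for x y
    using contractionsD(1)[OF T] by (simp add: cinner_adjoint_op_left cinner_adjoint_op)
  from sqrt_op_eq[OF lin norm this] show "positive_op (defect_op T)"
    and "defect_op T o\<^sub>L defect_op T = id_blinfun - (adjoint_op T o\<^sub>L T)"
    and "defect_op T = id_blinfun - sqrt_limit (adjoint_op T o\<^sub>L T)"
    by (simp_all add: defect_op_def)
qed

lemma defect_op:
  fixes T :: "'a :: complex_hilbert \<Rightarrow>\<^sub>L 'b :: complex_hilbert"
  assumes T: "T \<in> contractions"
  shows defect_op_clinear: "defect_op T \<in> clinear_op"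
    and defect_op_hermitian: "cinner (defect_op T x) y = cinner x (defect_op T y)"
    and defect_op_sq: "defect_op T (defect_op T x) = x - adjoint_op T (T x)"
    and norm_defect_op: "(norm (defect_op T x))\<^sup>2 = (norm x)\<^sup>2 - (norm (T x))\<^sup>2"
    and defect_op_intertwines: "T (defect_op T x) = defect_op (adjoint_op T) (T x)"
proof -
  note D = defect_op_sqrt_limit[OF T] and E = defect_op_sqrt_limit[OF adjoint_op_contractions[OF T]]
  have T': "T \<in> clinear_op"
    by (rule contractionsD(1)[OF T])
  show "defect_op T \<in> clinear_op"
    using D(2) by (simp add: positive_op_def)
  show herm: "cinner (defect_op T x) y = cinner x (defect_op T y)" for x y
    by (rule positive_op_hermitian[OF D(2)])
  show sq: "defect_op T (defect_op T x) = x - adjoint_op T (T x)" for x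
    using arg_cong[OF D(3), of "\<lambda>A. blinfun_apply A x"] by (simp add: blinfun.diff_left)
  have "cinner (defect_op T x) (defect_op T x) = cinner x x - cinner (T x) (T x)"
    by (simp add: herm sq cinner.diff_right cinner_adjoint_op[OF T'])
  then have "complex_of_real ((norm (defect_op T x))\<^sup>2) = complex_of_real ((norm x)\<^sup>2 - (norm (T x))\<^sup>2)"
    by (simp add: cinner_self)
  then show "(norm (defect_op T x))\<^sup>2 = (norm x)\<^sup>2 - (norm (T x))\<^sup>2"
    by (simp only: of_real_eq_iff)
  have "T (sqrt_limit (adjoint_op T o\<^sub>L T) x) = sqrt_limit (adjoint_op (adjoint_op T) o\<^sub>L adjoint_op T) (T x)"
    by (rule sqrt_limit_intertwines[OF D(1) E(1)]) (simp add: adjoint_op_adjoint_op[OF T'])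
  then show "T (defect_op T x) = defect_op (adjoint_op T) (T x)"
    unfolding D(4) E(4) by (simp add: blinfun.diff_left blinfun.diff_right)
qed

section \<open>Harnack's inequality and Pick equivalence\<close>

text \<open>The squares differ by \<open>4 * (Re a * Re b)\<close>. Thus the Cayley transform
  \<open>(a - b) / (a + cnj b)\<close> sends the right half plane into the disc.\<close>

lemma cmod_diff_less_add_cnj:
  assumes "0 < Re a" and "0 < Re b"
  shows "cmod (a - b) < cmod (a + cnj b)"
proof -
  have "(cmod (a + cnj b))\<^sup>2 - (cmod (a - b))\<^sup>2 = 4 * (Re a * Re b)"
    unfolding cmod_power2 by (simp add: power2_eq_square algebra_simps)
  moreover have "0 < Re a * Re b"
    using assms by simp
  ultimately show ?thesis
    by (intro power2_less_imp_less[OF _ norm_ge_zero]) linarith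
qed

text \<open>The Cayley transform \<open>w\<close> of \<open>f\<close> maps the disc into itself and
  vanishes at \<open>0\<close>, so the Schwarz lemma applies to it.\<close>

lemma harnack_strict:
  assumes "f holomorphic_on unit_disc" and pos: "\<And>z. z \<in> unit_disc \<Longrightarrow> 0 < Re (f z)"
    and l: "l \<in> unit_disc"
  shows "cmod (f l - f 0) \<le> cmod l * cmod (f l + cnj (f 0))"
proof -
  define w where "w z = (f z - f 0) / (f z + cnj (f 0))" for z
  have less: "cmod (f z - f 0) < cmod (f z + cnj (f 0))" if "z \<in> unit_disc" for z
    using that by (intro cmod_diff_less_add_cnj pos) auto
  then have nz: "f z + cnj (f 0) \<noteq> 0" if "z \<in> unit_disc" for z
    using that by fastforce
  have hol: "w holomorphic_on unit_disc"
    unfolding w_def using nz by (intro holomorphic_intros assms) auto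
  have bound: "cmod (w z) < 1" if "cmod z < 1" for z
    using less[of z] nz[of z] that by (simp add: w_def norm_divide)
  have "w 0 = 0"
    by (simp add: w_def)
  from Schwarz_Lemma(1)[OF hol this bound, of l] l have "cmod (w l) \<le> cmod l"
    by simp
  then show ?thesis
    using nz[OF l] by (simp add: w_def norm_divide divide_le_eq)
qed

text \<open>Stated for moduli instead of real parts because \<open>pick_gap\<close> is a modulus; it
  follows from the Schwarz estimate and the triangle inequality.\<close>

lemma harnack:
  assumes f: "f holomorphic_on unit_disc" and pos: "\<And>z. z \<in> unit_disc \<Longrightarrow> 0 \<le> Re (f z)"
    and l: "l \<in> unit_disc"
  shows "cmod (f l) \<le> (1 + cmod l) / (1 - cmod l) * cmod (f 0)"
    and "cmod (f 0) \<le> (1 + cmod l) / (1 - cmod l) * cmod (f l)"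
proof -
  have l1: "cmod l < 1"
    using l by simp
  have le: "cmod (f l - f 0) \<le> cmod l * (cmod (f l) + cmod (f 0))"
  proof (rule field_le_epsilon)
    fix e :: real
    assume e: "0 < e"
    \<comment> \<open>Adding \<open>e / 2\<close> to \<open>f\<close> makes the real part strictly
      positive; the shift cancels in the difference and contributes \<open>e\<close> to the
      sum.\<close>
    have "cmod ((f l + of_real (e / 2)) - (f 0 + of_real (e / 2)))
        \<le> cmod l * cmod ((f l + of_real (e / 2)) + cnj (f 0 + of_real (e / 2)))"
      by (rule harnack_strict[of "\<lambda>z. f z + of_real (e / 2)"])
        (use pos e l in \<open>auto intro!: holomorphic_intros f add_nonneg_pos\<close>)
    also have "(f l + of_real (e / 2)) + cnj (f 0 + of_real (e / 2)) = f l + cnj (f 0) + of_real e"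
      by (simp flip: of_real_add)
    also have "cmod (f l + cnj (f 0) + of_real e) \<le> cmod (f l) + cmod (f 0) + e"
      using e by (intro norm_triangle_le add_mono) auto
    finally have "cmod (f l - f 0) \<le> cmod l * (cmod (f l) + cmod (f 0) + e)"
      by (simp add: mult_left_mono)
    also have "\<dots> \<le> cmod l * (cmod (f l) + cmod (f 0)) + e"
      using l1 e by (simp add: distrib_left mult_left_le_one_le)
    finally show "cmod (f l - f 0) \<le> cmod l * (cmod (f l) + cmod (f 0)) + e" .
  qed
  have "cmod (f l) - cmod (f 0) \<le> cmod (f l - f 0)" "cmod (f 0) - cmod (f l) \<le> cmod (f l - f 0)"
    using norm_triangle_ineq2[of "f l" "f 0"] norm_triangle_ineq2[of "f 0" "f l"]
    by (simp_all add: norm_minus_commute)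
  with le have "cmod (f l) * (1 - cmod l) \<le> (1 + cmod l) * cmod (f 0)"
    "cmod (f 0) * (1 - cmod l) \<le> (1 + cmod l) * cmod (f l)"
    by (simp_all add: algebra_simps)
  then show "cmod (f l) \<le> (1 + cmod l) / (1 - cmod l) * cmod (f 0)"
    and "cmod (f 0) \<le> (1 + cmod l) / (1 - cmod l) * cmod (f l)"
    using l1 by (simp_all add: pos_le_divide_eq)
qed

section \<open>Pick equivalence\<close>

definition pick_gap ::
    "('a :: complex_hilbert \<Rightarrow>\<^sub>L 'b :: complex_hilbert) \<Rightarrow> ('a \<Rightarrow>\<^sub>L 'b) \<Rightarrow> 'a \<Rightarrow> real"
  where "pick_gap T T' x = cmod (cinner x x - cinner (T' x) (T x))"

definition pick_equivalent ::
    "('a :: complex_hilbert \<Rightarrow>\<^sub>L 'b :: complex_hilbert) \<Rightarrow> ('a \<Rightarrow>\<^sub>L 'b) \<Rightarrow> bool"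
  where "pick_equivalent T T' \<longleftrightarrow> (\<exists>C\<ge>0. \<forall>x.
    pick_gap T T' x \<le> C * pick_gap T T x \<and> pick_gap T T' x \<le> C * pick_gap T' T' x)"

lemma pick_gap_commute: "pick_gap T T' x = pick_gap T' T x"
proof -
  have "cinner x x - cinner (T' x) (T x) = cnj (cinner x x - cinner (T x) (T' x))"
    unfolding complex_cnj_diff cinner_commute[symmetric] ..
  then show ?thesis
    by (simp only: pick_gap_def complex_mod_cnj)
qed

lemma pick_equivalent_sym: "pick_equivalent T T' \<Longrightarrow> pick_equivalent T' T"
  unfolding pick_equivalent_def pick_gap_commute[of T' T] by blast

lemma pick_gap_self:
  assumes "T \<in> contractions"
  shows "pick_gap T T x = (norm x)\<^sup>2 - (norm (T x))\<^sup>2"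
proof -
  have "(norm (T x))\<^sup>2 \<le> (norm x)\<^sup>2"
    using contractionsD(3)[OF assms] by (simp add: power_mono)
  moreover have "cinner x x - cinner (T x) (T x) = complex_of_real ((norm x)\<^sup>2 - (norm (T x))\<^sup>2)"
    by (simp add: cinner_self)
  ultimately show ?thesis
    unfolding pick_gap_def by (simp only: norm_of_real)
qed

text \<open>The left side equals twice the real part of the number whose modulus is
  \<open>pick_gap T T' x\<close>. Its last term controls \<open>T' - T\<close>.\<close>

lemma pick_gap_lower:
  assumes "T \<in> contractions" and "T' \<in> contractions"
  shows "pick_gap T T x + pick_gap T' T' x + (norm (T' x - T x))\<^sup>2 \<le> 2 * pick_gap T T' x"
  using complex_Re_le_cmod[of "cinner x x - cinner (T' x) (T x)"]
  by (simp add: pick_gap_self assms norm_diff_sq cinner_self)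
    (simp add: pick_gap_def cinner_self)

lemma pick_equivalent_trans:
  assumes T: "T \<in> contractions" "T' \<in> contractions" "T'' \<in> contractions"
    and "pick_equivalent T T'" and "pick_equivalent T' T''"
  shows "pick_equivalent T T''"
proof -
  obtain C1 where C1: "0 \<le> C1" "\<And>x. pick_gap T T' x \<le> C1 * pick_gap T T x"
      "\<And>x. pick_gap T T' x \<le> C1 * pick_gap T' T' x"
    using assms(4) by (auto simp: pick_equivalent_def)
  obtain C2 where C2: "0 \<le> C2" "\<And>x. pick_gap T' T'' x \<le> C2 * pick_gap T' T' x"
      "\<And>x. pick_gap T' T'' x \<le> C2 * pick_gap T'' T'' x"
    using assms(5) by (auto simp: pick_equivalent_def)
  \<comment> \<open>A generous constant: it suffices to insert \<open>g1 \<le> C1 * a\<close> and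
    \<open>g2 \<le> 2 * C1 * C2 * a\<close>, or their mirror images with \<open>c\<close>, into
    \<open>2 * g1 + 2 * g2\<close>.\<close>
  define C where "C = 4 * C1 + 4 * C2 + 8 * C1 * C2"
  have "pick_gap T T'' x \<le> C * pick_gap T T x \<and> pick_gap T T'' x \<le> C * pick_gap T'' T'' x" for x
  proof -
    define a b c g1 g2 where "a = pick_gap T T x" and "b = pick_gap T' T' x"
      and "c = pick_gap T'' T'' x" and "g1 = pick_gap T T' x" and "g2 = pick_gap T' T'' x"
    have nonneg: "0 \<le> a" "0 \<le> b" "0 \<le> c"
      by (simp_all add: a_def b_def c_def pick_gap_def)
    define p q where "p = norm (T'' x - T' x)" and "q = norm (T' x - T x)"
    have g1: "a + b + q\<^sup>2 \<le> 2 * g1"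
      using pick_gap_lower[OF T(1,2)] by (simp add: a_def b_def g1_def q_def)
    have g2: "b + c + p\<^sup>2 \<le> 2 * g2"
      using pick_gap_lower[OF T(2,3)] by (simp add: b_def c_def g2_def p_def)
    \<comment> \<open>Inserting \<open>T'\<close> leaves a cross term of modulus at most
      \<open>p * q\<close>; the squares of \<open>p\<close> and \<open>q\<close> are absorbed by
      \<open>g1\<close> and \<open>g2\<close>.\<close>
    have split: "cinner x x - cinner (T'' x) (T x) = (cinner x x - cinner (T'' x) (T' x))
        + (cinner x x - cinner (T' x) (T x)) - (cinner x x - cinner (T' x) (T' x))
        + cinner (T'' x - T' x) (T' x - T x)"
      by (simp add: cinner.diff_left cinner.diff_right)
    have "pick_gap T T'' x \<le> g2 + g1 + b + p * q"
      unfolding g1_def g2_def b_def p_def q_def pick_gap_def split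
      by (intro norm_triangle_le norm_triangle_le_diff add_mono order_refl cinner_Cauchy_Schwarz)
    also have "2 * (p * q) \<le> p\<^sup>2 + q\<^sup>2"
      using zero_le_power2[of "p - q"] by (simp add: power2_diff)
    then have "g2 + g1 + b + p * q \<le> 2 * g1 + 2 * g2"
      using g1 g2 nonneg by linarith
    finally have le: "pick_gap T T'' x \<le> 2 * g1 + 2 * g2" .
    have b: "b \<le> 2 * g1" "b \<le> 2 * g2"
      using g1 g2 nonneg zero_le_power2[of p] zero_le_power2[of q] by linarith+
    have g: "g1 \<le> C1 * a" "g1 \<le> C1 * b" "g2 \<le> C2 * b" "g2 \<le> C2 * c"
      using C1 C2 by (simp_all add: a_def b_def c_def g1_def g2_def)
    \<comment> \<open>Passage through the middle gap: \<open>g2 \<le> C2 * b\<close>,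
      \<open>b \<le> 2 * g1\<close>, \<open>g1 \<le> C1 * a\<close>.\<close>
    have "g2 \<le> 2 * C1 * C2 * a"
    proof -
      have "C2 * b \<le> C2 * (2 * (C1 * a))"
        using b(1) g(1) C2(1) by (intro mult_left_mono) auto
      then show ?thesis
        using g(3) by (simp add: mult_ac)
    qed
    moreover have "g1 \<le> 2 * C1 * C2 * c"
    proof -
      have "C1 * b \<le> C1 * (2 * (C2 * c))"
        using b(2) g(4) C1(1) by (intro mult_left_mono) auto
      then show ?thesis
        using g(2) by (simp add: mult_ac)
    qed
    moreover have "0 \<le> C1 * a" "0 \<le> C1 * c" "0 \<le> C2 * a" "0 \<le> C2 * c"
        "0 \<le> C1 * C2 * a" "0 \<le> C1 * C2 * c"
      using nonneg C1(1) C2(1) by simp_all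
    ultimately have "pick_gap T T'' x \<le> C * a" "pick_gap T T'' x \<le> C * c"
      using le g unfolding C_def by (simp_all add: algebra_simps)
    then show ?thesis
      by (simp add: a_def c_def)
  qed
  moreover have "0 \<le> C"
    using C1(1) C2(1) by (simp add: C_def)
  ultimately show ?thesis
    by (auto simp: pick_equivalent_def)
qed

section \<open>Schur functions and Kobayashi chains\<close>

lemma schur_class_contractions: "F \<in> schur_class \<Longrightarrow> z \<in> unit_disc \<Longrightarrow> F z \<in> contractions"
  by (simp add: schur_class_def contractions_def)

lemma schur_class_cinner_holomorphic:
  assumes "F \<in> schur_class"
  shows "(\<lambda>z. cinner (F z x) y) holomorphic_on unit_disc"
proof (rule holomorphic_onI)
  fix z
  assume "z \<in> unit_disc"
  then obtain D where D: "(F has_derivative (\<lambda>h. h *\<^sub>C D)) (at z)"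
    using assms unfolding schur_class_def vector_analytic_on_def by blast
  have "bounded_linear (\<lambda>A :: 'a \<Rightarrow>\<^sub>L 'b. cinner (A x) y)"
    by (rule bounded_linear_compose[OF cinner.bounded_linear_left blinfun.bounded_linear_left])
  from bounded_linear.has_derivative[OF this D]
  have "((\<lambda>z. cinner (F z x) y) has_field_derivative cinner (D x) y) (at z)"
    by (simp add: has_field_derivative_def scaleC_blinfun.rep_eq cinner_scaleC_left mult_commute_abs)
  then show "(\<lambda>z. cinner (F z x) y) field_differentiable at z within unit_disc"
    using field_differentiable_at_within field_differentiable_def by blast
qed

text \<open>Harnack with \<open>A = F 0\<close> compares the mixed gap with the gap at
  \<open>F 0\<close>; with \<open>A = F l\<close> it compares it with the gap at \<open>F l\<close>,
  after exchanging the arguments of the mixed gap.\<close>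

lemma schur_class_pick_equivalent:
  assumes F: "F \<in> schur_class" and l: "l \<in> unit_disc"
  shows "pick_equivalent (F 0) (F l)"
proof -
  define C where "C = (1 + cmod l) / (1 - cmod l)"
  have harn: "pick_gap A (F l) x \<le> C * pick_gap A (F 0) x"
    "pick_gap A (F 0) x \<le> C * pick_gap A (F l) x" if A: "A \<in> contractions" for A x
  proof -
    define f where "f z = cinner x x - cinner (F z x) (A x)" for z
    have hol: "f holomorphic_on unit_disc"
      unfolding f_def by (intro holomorphic_intros schur_class_cinner_holomorphic F)
    have "0 \<le> Re (f z)" if z: "z \<in> unit_disc" for z
    proof -
      have "Re (cinner (F z x) (A x)) \<le> norm (F z x) * norm (A x)"
        using complex_Re_le_cmod cinner_Cauchy_Schwarz order_trans by blast
      also have "\<dots> \<le> norm x * norm x"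
        using schur_class_contractions[OF F z] A by (intro mult_mono contractionsD) auto
      finally show ?thesis
        by (simp add: f_def cinner_self power2_eq_square)
    qed
    from harnack[OF hol this l] show "pick_gap A (F l) x \<le> C * pick_gap A (F 0) x"
      "pick_gap A (F 0) x \<le> C * pick_gap A (F l) x"
      by (simp_all add: pick_gap_def C_def f_def)
  qed
  have contr: "F 0 \<in> contractions" "F l \<in> contractions"
    using schur_class_contractions[OF F] l by auto
  have "0 \<le> C"
    using l by (simp add: C_def)
  with harn(1)[OF contr(1)] harn(2)[OF contr(2)] show ?thesis
    by (auto simp: pick_equivalent_def pick_gap_commute[of "F 0" "F l"])
qed

text \<open>A finite infimum is taken over a nonempty set, so a chain exists; equivalence then
  propagates link by link.\<close>

lemma kobayashi_finite_pick_equivalent: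
  assumes "kobayashi_dist T T' < \<infinity>"
  shows "pick_equivalent T T'"
proof -
  obtain n l F where n: "1 \<le> (n :: nat)" and l: "\<And>j. j \<in> {1..n} \<Longrightarrow> l j \<in> unit_disc"
    and F: "\<And>j. j \<in> {1..n} \<Longrightarrow> F j \<in> schur_class" "F 1 0 = T"
      "\<And>j. j \<in> {1..<n} \<Longrightarrow> F j (l j) = F (j + 1) 0" "F n (l n) = T'"
  proof -
    have ne: "A \<noteq> {}" if "Inf A < \<infinity>" for A :: "ennreal set"
      using that by auto
    have "{ennreal (\<Sum>j=1..n. hyperbolic_dist 0 (l j)) | (n :: nat) (l :: nat \<Rightarrow> complex).
      1 \<le> n \<and> (\<forall>j\<in>{1..n}. l j \<in> unit_disc) \<and>
      (\<exists>F :: nat \<Rightarrow> complex \<Rightarrow> 'a \<Rightarrow>\<^sub>L 'b.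
        (\<forall>j\<in>{1..n}. F j \<in> schur_class) \<and>
        F 1 0 = T \<and>
        (\<forall>j\<in>{1..<n}. F j (l j) = F (j + 1) 0) \<and>
        F n (l n) = T')} \<noteq> {}"
      using assms unfolding kobayashi_dist_def by (rule ne)
    then show thesis
      using that by blast
  qed
  \<comment> \<open>Links are numbered from \<open>1\<close>: the base case is vacuous and the first
    link appears as \<open>Suc 0\<close>.\<close>
  have "k \<in> {1..n} \<longrightarrow> pick_equivalent T (F k (l k))" for k
  proof (induction k)
    case (Suc k)
    have step: "pick_equivalent (F (Suc k) 0) (F (Suc k) (l (Suc k)))" if "Suc k \<in> {1..n}"
      using that by (intro schur_class_pick_equivalent F l)
    show ?case
    proof (cases "k = 0")
      case True
      then show ?thesis
        using step F(2) by simp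
    next
      case False
      show ?thesis
      proof
        assume Sk: "Suc k \<in> {1..n}"
        with False have k: "k \<in> {1..n}" "k \<in> {1..<n}"
          by auto
        have eq: "F (Suc k) 0 = F k (l k)"
          using F(3)[OF k(2)] by simp
        have "T \<in> contractions"
          using schur_class_contractions[of "F 1" 0] F(1)[of 1] F(2) n by simp
        then show "pick_equivalent T (F (Suc k) (l (Suc k)))"
          using Suc k step[OF Sk] schur_class_contractions[OF F(1)[OF k(1)] l[OF k(1)]]
            schur_class_contractions[OF F(1)[OF Sk] l[OF Sk]]
          unfolding eq by (blast intro: pick_equivalent_trans)
      qed
    qed
  qed simp
  from this[of n] n F(4) show ?thesis
    by simp
qed

section \<open>Pick equivalence implies Shmul'yan equivalence\<close>

text \<open>For positive \<open>a\<close> and \<open>b\<close> the optimal \<open>s\<close> has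
  square \<open>b / a\<close>, and there both summands equal \<open>a * b\<close>.\<close>

lemma quadratic_scaling_bound:
  fixes a b K q :: real
  assumes "0 \<le> a" "0 \<le> b" "0 \<le> K" and le: "\<And>s. 0 < s \<Longrightarrow> q \<le> K * (s\<^sup>2 * a\<^sup>2 + b\<^sup>2 / s\<^sup>2)"
  shows "q \<le> 2 * K * a * b"
proof (rule field_le_epsilon)
  fix e :: real
  assume e: "0 < e"
  \<comment> \<open>The shift \<open>d\<close> keeps the quotient defining \<open>s\<close>
    meaningful when \<open>a\<close> or \<open>b\<close> vanishes; its size makes the excess
    \<open>d * (K * (a + b))\<close> at most \<open>e\<close>.\<close>
  define d where "d = e / (K * (a + b) + 1)"
  have den: "0 < K * (a + b) + 1"
    using assms(1-3) by (simp add: add_nonneg_pos)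
  have d: "0 < d"
    using e den by (simp add: d_def)
  have pos: "0 < a + d" "0 < b + d"
    using d assms(1,2) by auto
  define s where "s = sqrt ((b + d) / (a + d))"
  have s: "0 < s" "s\<^sup>2 = (b + d) / (a + d)"
    using pos by (simp_all add: s_def)
  have "s\<^sup>2 * a\<^sup>2 = (b + d) * a * (a / (a + d))"
    unfolding s(2) by (simp add: power2_eq_square)
  also have "\<dots> \<le> (b + d) * a * 1"
    using pos assms(1) d by (intro mult_left_mono) auto
  finally have 1: "s\<^sup>2 * a\<^sup>2 \<le> (b + d) * a"
    by simp
  have "b\<^sup>2 / s\<^sup>2 = (a + d) * b * (b / (b + d))"
    unfolding s(2) by (simp add: power2_eq_square)
  also have "\<dots> \<le> (a + d) * b * 1"
    using pos assms(2) d by (intro mult_left_mono) auto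
  finally have "b\<^sup>2 / s\<^sup>2 \<le> (a + d) * b"
    by simp
  with 1 have "K * (s\<^sup>2 * a\<^sup>2 + b\<^sup>2 / s\<^sup>2) \<le> K * ((b + d) * a + (a + d) * b)"
    using assms(3) by (intro mult_left_mono) auto
  then have "q \<le> K * ((b + d) * a + (a + d) * b)"
    using le[OF s(1)] by linarith
  also have "\<dots> = 2 * K * a * b + d * (K * (a + b))"
    by (simp add: algebra_simps)
  also have "d * (K * (a + b)) \<le> d * (K * (a + b) + 1)"
    using d by (intro mult_left_mono) auto
  also have "d * (K * (a + b) + 1) = e"
    using den by (simp add: d_def)
  finally show "q \<le> 2 * K * a * b + e"
    by simp
qed

text \<open>Polarization bounds the form by a sum of two squares. Replacing \<open>u\<close>,
  \<open>v\<close> by \<open>s *\<^sub>R u\<close>, \<open>(1 / s) *\<^sub>R v\<close> leaves the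
  form unchanged, and optimizing over \<open>s\<close> turns the sum into a product.\<close>

lemma polarization_bound:
  fixes S T :: "'a :: complex_hilbert \<Rightarrow>\<^sub>L 'b :: complex_hilbert" and D :: "'a \<Rightarrow>\<^sub>L 'c :: complex_hilbert"
  assumes S: "S \<in> clinear_op" and T: "T \<in> clinear_op" and D: "D \<in> clinear_op"
    and bound: "\<And>x. cmod (cinner (S x) (T x)) \<le> K * (norm (D x))\<^sup>2" and K: "0 \<le> K"
  shows "cmod (cinner (S u) (T v)) \<le> 2 * K * norm (D u) * norm (D v)"
proof (rule quadratic_scaling_bound)
  have le: "cmod (cinner (S u) (T v)) \<le> K * ((norm (D u))\<^sup>2 + (norm (D v))\<^sup>2)" for u v
  proof -
    define Q where "Q x = cinner (S x) (T x)" for x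
    have Q: "Q (u + c *\<^sub>C v) = Q u + cnj c * cinner (S u) (T v) + c * cinner (S v) (T u) + (c * cnj c) * Q v"
      for c
      by (simp add: Q_def blinfun.add_right clinear_opD[OF S] clinear_opD[OF T] cinner_add_left
          cinner_add_right cinner_scaleC_left cinner_scaleC_right algebra_simps)
    have eq: "4 * cinner (S u) (T v) = Q (u + 1 *\<^sub>C v) + - Q (u + (-1) *\<^sub>C v)
        + \<i> * Q (u + \<i> *\<^sub>C v) + (- \<i>) * Q (u + (- \<i>) *\<^sub>C v)"
      unfolding Q by (simp add: algebra_simps)
    have "cmod (Q (u + c *\<^sub>C v)) \<le> K * ((norm (D u))\<^sup>2 + 2 * Re (cinner (D u) (c *\<^sub>C D v)) + (norm (D v))\<^sup>2)"
      if "cmod c = 1" for c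
      using bound[of "u + c *\<^sub>C v"] that
      by (simp add: Q_def blinfun.add_right clinear_opD[OF D] norm_add_sq norm_scaleC)
    \<comment> \<open>Summed over the four values of \<open>c\<close>, the cross terms
      cancel.\<close>
    note this[of 1] this[of "-1"] this[of \<i>] this[of "- \<i>"]
    then have bounds: "cmod (Q (u + 1 *\<^sub>C v)) + cmod (Q (u + (-1) *\<^sub>C v))
        + cmod (Q (u + \<i> *\<^sub>C v)) + cmod (Q (u + (- \<i>) *\<^sub>C v))
        \<le> 4 * (K * ((norm (D u))\<^sup>2 + (norm (D v))\<^sup>2))"
      by (simp add: cinner_scaleC_right algebra_simps)
    have "4 * cmod (cinner (S u) (T v)) = cmod (4 * cinner (S u) (T v))"
      by (simp add: norm_mult)
    also have "\<dots> \<le> cmod (Q (u + 1 *\<^sub>C v)) + cmod (- Q (u + (-1) *\<^sub>C v))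
        + cmod (\<i> * Q (u + \<i> *\<^sub>C v)) + cmod ((- \<i>) * Q (u + (- \<i>) *\<^sub>C v))"
      unfolding eq by (intro norm_triangle_le add_mono order_refl)
    also have "\<dots> = cmod (Q (u + 1 *\<^sub>C v)) + cmod (Q (u + (-1) *\<^sub>C v))
        + cmod (Q (u + \<i> *\<^sub>C v)) + cmod (Q (u + (- \<i>) *\<^sub>C v))"
      by (simp only: norm_mult norm_minus_cancel norm_ii mult_1)
    finally show ?thesis
      using bounds by linarith
  qed
  show "cmod (cinner (S u) (T v)) \<le> K * (s\<^sup>2 * (norm (D u))\<^sup>2 + (norm (D v))\<^sup>2 / s\<^sup>2)" if s: "0 < s" for s
    using le[of "s *\<^sub>R u" "(1 / s) *\<^sub>R v"] s
    by (simp add: blinfun.scaleR_right cinner_scaleR_left cinner_scaleR_right power_mult_distrib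
        power_divide)
qed (use K in auto)

text \<open>The difference \<open>S\<close> is factored in two stages: Riesz over the range of
  \<open>E\<close> gives \<open>S = E h\<close>, and Douglas factorization then gives
  \<open>h = Y D\<close>.\<close>

lemma pick_equivalent_shmulyan_dominates:
  fixes T T' :: "'a :: complex_hilbert \<Rightarrow>\<^sub>L 'b :: complex_hilbert"
  assumes T: "T \<in> contractions" and T': "T' \<in> contractions" and "pick_equivalent T T'"
  shows "shmulyan_dominates T T'"
proof -
  obtain C where C: "0 \<le> C" and gap: "\<And>x. pick_gap T T' x \<le> C * pick_gap T T x"
    using assms(3) by (auto simp: pick_equivalent_def)
  define S D E where "S = T' - T" and "D = defect_op T" and "E = defect_op (adjoint_op T)"
  have lin: "T \<in> clinear_op" "T' \<in> clinear_op"
    using T T' by (simp_all add: contractionsD)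
  have adj: "adjoint_op T \<in> contractions"
    by (rule adjoint_op_contractions[OF T])
  have D: "D \<in> clinear_op" and E: "E \<in> clinear_op" and S: "S \<in> clinear_op"
    unfolding D_def E_def S_def by (intro defect_op_clinear T adj clinear_op_diff lin)+
  have S_app: "S x = T' x - T x" for x
    by (simp add: S_def blinfun.diff_left)
  have gap_self: "pick_gap T T x = (norm (D x))\<^sup>2" for x
    by (simp add: pick_gap_self[OF T] D_def norm_defect_op[OF T])
  have norm_S: "norm (S x) \<le> sqrt (2 * C) * norm (D x)" for x
  proof -
    have "0 \<le> pick_gap T T x" "0 \<le> pick_gap T' T' x"
      by (simp_all add: pick_gap_def)
    then have "(norm (S x))\<^sup>2 \<le> 2 * C * (norm (D x))\<^sup>2"
      using pick_gap_lower[OF T T', of x] gap[of x] unfolding S_app gap_self by linarith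
    from real_sqrt_le_mono[OF this] show ?thesis
      by (simp add: real_sqrt_mult)
  qed
  have "cmod (cinner (S x) (T x)) \<le> (C + 1) * (norm (D x))\<^sup>2" for x
  proof -
    have "cinner (S x) (T x)
        = (cinner x x - cinner (T x) (T x)) - (cinner x x - cinner (T' x) (T x))"
      by (simp add: S_app cinner.diff_left)
    then have "cmod (cinner (S x) (T x)) \<le> pick_gap T T x + pick_gap T T' x"
      unfolding pick_gap_def by (simp only: norm_triangle_ineq4)
    then show ?thesis
      using gap[of x] by (simp add: gap_self algebra_simps)
  qed
  from polarization_bound[OF S lin(1) D this] C
  have ST: "cmod (cinner (S u) (T v)) \<le> 2 * (C + 1) * norm (D u) * norm (D v)" for u v
    by simp
  have E_le: "norm (E y) \<le> norm y" for y
    using norm_defect_op[OF adj, of y] by - (rule power2_le_imp_le, simp_all add: E_def)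
  define K where "K = 2 * (C + 1) + sqrt (2 * C)"
  have K: "0 \<le> K"
    using C by (simp add: K_def)
  \<comment> \<open>Decompose \<open>y = T T* y + E (E y)\<close>. The first part is controlled by
    \<open>ST\<close> and the relation \<open>D T* = T* E\<close>, the second by
    \<open>norm_S\<close>.\<close>
  have SE: "cmod (cinner y (S d)) \<le> (K * norm (D d)) * norm (E y)" for d y
  proof -
    have "E (E y) = y - T (adjoint_op T y)"
      by (simp add: E_def defect_op_sq[OF adj] adjoint_op_adjoint_op[OF lin(1)])
    then have "cinner (S d) y = cinner (S d) (T (adjoint_op T y)) + cinner (S d) (E (E y))"
      by (simp add: cinner.diff_right)
    then have "cmod (cinner (S d) y)
        \<le> cmod (cinner (S d) (T (adjoint_op T y))) + cmod (cinner (E (S d)) (E y))"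
      by (metis norm_triangle_ineq E_def defect_op_hermitian[OF adj])
    also have "\<dots> \<le> 2 * (C + 1) * norm (D d) * norm (E y) + (sqrt (2 * C) * norm (D d)) * norm (E y)"
    proof (rule add_mono)
      have "D (adjoint_op T y) = adjoint_op T (E y)"
        using defect_op_intertwines[OF adj, of y] by (simp add: D_def E_def adjoint_op_adjoint_op[OF lin(1)])
      then have "norm (D (adjoint_op T y)) \<le> norm (E y)"
        by (simp add: contractionsD(3)[OF adj])
      then have "2 * (C + 1) * norm (D d) * norm (D (adjoint_op T y)) \<le> 2 * (C + 1) * norm (D d) * norm (E y)"
        using C by (intro mult_left_mono) auto
      then show "cmod (cinner (S d) (T (adjoint_op T y))) \<le> 2 * (C + 1) * norm (D d) * norm (E y)"
        using ST order_trans by blast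
      have "cmod (cinner (E (S d)) (E y)) \<le> norm (E (S d)) * norm (E y)"
        by (rule cinner_Cauchy_Schwarz)
      also have "\<dots> \<le> (sqrt (2 * C) * norm (D d)) * norm (E y)"
        using E_le norm_S order_trans by (intro mult_right_mono) (blast, simp)
      finally show "cmod (cinner (E (S d)) (E y)) \<le> (sqrt (2 * C) * norm (D d)) * norm (E y)" .
    qed
    also have "\<dots> = (K * norm (D d)) * norm (E y)"
      by (simp add: K_def algebra_simps)
    finally show ?thesis
      by (subst cinner_commute) simp
  qed
  have "norm (D d) \<le> norm d" for d
    using norm_defect_op[OF T, of d] by - (rule power2_le_imp_le, simp_all add: D_def)
  then have ND: "K * norm (D d) \<le> K * norm d" for d
    using K by (intro mult_left_mono) auto
  \<comment> \<open>The pointwise bound \<open>K * norm (D d)\<close>, and not merely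
    \<open>K * norm d\<close>, is what Douglas factorization needs next.\<close>
  have "\<exists>h\<in>clinear_op. norm h \<le> K \<and> (\<forall>d. blinfun_apply h d \<in> closure (range E)
      \<and> norm (h d) \<le> K * norm (D d) \<and> (\<forall>y. cinner y (S d) = cinner (E y) (h d)))"
    using SE ND K
    by (intro riesz_range_family[OF E])
      (auto simp: cinner_add_left cinner_scaleC_left blinfun.add_right clinear_opD[OF S]
        cinner_add_right cinner_scaleC_right)
  then obtain h where h: "h \<in> clinear_op" "\<And>d. blinfun_apply h d \<in> closure (range E)"
      "\<And>d. norm (h d) \<le> K * norm (D d)" "\<And>d y. cinner y (S d) = cinner (E y) (h d)"
    by metis
  have S_eq: "S d = E (h d)" for d
  proof (rule cinner_ext)
    show "cinner y (S d) = cinner y (E (h d))" for y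
      unfolding h(4) unfolding E_def by (rule defect_op_hermitian[OF adj])
  qed
  obtain Y where Y: "Y \<in> clinear_op" "\<And>x. h x = blinfun_apply Y (D x)"
    using douglas_factorization[OF D h(1,3) K] by metis
  have "Y ` closure (range D) \<subseteq> closure (range E)"
    using h(2) Y(2)
    by (intro image_closure_subset closed_closure continuous_intros) auto
  then have "bounded_op_between (closure (range D)) (closure (range E)) Y"
    using norm_blinfun[of Y]
    by (auto simp: bounded_op_between_def blinfun.add_right clinear_opD[OF Y(1)])
  moreover have "T' x = T x + E (Y (D x))" for x
    using S_eq[of x] Y(2)[of x] by (simp add: S_app algebra_simps)
  ultimately show ?thesis
    unfolding shmulyan_dominates_def defect_space_def D_def E_def by blast
qed

section \<open>Schur functions through Shmul'yan equivalent contractions\<close>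

text \<open>The value of \<open>R\<close> at \<open>x\<close> is the unique fixed point of the
  contraction sending \<open>y\<close> to \<open>x - A y\<close>; uniqueness yields linearity and
  the left inverse property.\<close>

lemma clinear_op_inverse_id_plus:
  fixes A :: "'a :: complex_hilbert \<Rightarrow>\<^sub>L 'a"
  assumes A: "A \<in> clinear_op" and less: "norm A < 1"
  shows "\<exists>R\<in>clinear_op. norm R \<le> 1 / (1 - norm A) \<and>
    (\<forall>x. blinfun_apply R x + A (R x) = x) \<and> (\<forall>x. blinfun_apply R (x + A x) = x)"
proof -
  have "\<exists>!y. x - A y = y" for x
  proof (rule banach_fix_type)
    have "dist (x - A y) (x - A z) = norm (A (z - y))" for y z
      by (simp add: dist_norm blinfun.diff_right)
    then show "\<forall>y z. dist (x - A y) (x - A z) \<le> norm A * dist y z"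
      by (metis norm_blinfun dist_norm norm_minus_commute)
  qed (use less in auto)
  then obtain r where r: "\<And>x. x - A (r x) = r x" and unique: "\<And>x y. x - A y = y \<Longrightarrow> y = r x"
    by metis
  have "r (x + y) = r x + r y" for x y
    using r[of x] r[of y]
    by (intro unique[symmetric]) (simp add: blinfun.add_right algebra_simps)
  moreover have "r (c *\<^sub>C x) = c *\<^sub>C r x" for c x
    by (intro unique[symmetric]) (simp add: clinear_opD[OF A] r flip: scaleC_diff_right)
  moreover have "norm (r x) \<le> 1 / (1 - norm A) * norm x" for x
  proof -
    have "norm (r x) \<le> norm x + norm A * norm (r x)"
      by (subst r[symmetric]) (intro norm_triangle_le_diff add_mono norm_blinfun order_refl)
    then show ?thesis
      using less by (simp add: field_simps)
  qed
  ultimately obtain R where R: "R \<in> clinear_op" "\<And>x. blinfun_apply R x = r x" "norm R \<le> 1 / (1 - norm A)"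
    using clinear_opI[of r "1 / (1 - norm A)"] less by auto
  moreover have "r x + A (r x) = x" for x
    using r[of x] by (metis diff_add_cancel)
  moreover have "r (x + A x) = x" for x
    by (intro unique[symmetric]) simp
  ultimately show ?thesis
    by (intro bexI[of _ R]) simp_all
qed

lemma has_derivative_quadratic_error:
  fixes f :: "'a :: real_normed_vector \<Rightarrow> 'b :: real_normed_vector"
  assumes "bounded_linear f'" and "0 < d"
    and err: "\<And>y. norm (y - x) < d \<Longrightarrow> norm (f y - f x - f' (y - x)) \<le> C * (norm (y - x))\<^sup>2"
  shows "(f has_derivative f') (at x)"
  unfolding has_derivative_at_alt
proof (intro conjI allI impI assms(1))
  fix e :: real
  assume e: "0 < e"
  define d' where "d' = min d (e / (\<bar>C\<bar> + 1))"
  have "norm (f y - f x - f' (y - x)) \<le> e * norm (y - x)" if y: "norm (y - x) < d'" for y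
  proof -
    have "norm (f y - f x - f' (y - x)) \<le> C * (norm (y - x))\<^sup>2"
      using y by (intro err) (simp add: d'_def)
    also have "\<dots> \<le> (\<bar>C\<bar> + 1) * (norm (y - x))\<^sup>2"
      by (intro mult_right_mono) auto
    also have "\<dots> = ((\<bar>C\<bar> + 1) * norm (y - x)) * norm (y - x)"
      by (simp add: power2_eq_square)
    also have "\<dots> \<le> e * norm (y - x)"
      using y by (intro mult_right_mono) (simp_all add: d'_def field_simps)
    finally show ?thesis .
  qed
  then show "\<exists>d>0. \<forall>y. norm (y - x) < d \<longrightarrow> norm (f y - f x - f' (y - x)) \<le> e * norm (y - x)"
    using e assms(2) by (intro exI[of _ d']) (simp add: d'_def)
qed

lemma bounded_linear_scaleC_left:
  "bounded_linear (\<lambda>c. c *\<^sub>C (x :: 'a :: complex_normed_vector))"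
  by (rule bounded_linear_intro[where K = "norm x"])
    (simp_all add: scaleC_add_left norm_scaleC scaleR_scaleC[of _ "_ *\<^sub>C x"] scaleC_scaleC
      scaleR_conv_of_real)

text \<open>With \<open>R z = (1 + z A)\<^sup>-\<^sup>1\<close>, the resolvent identity gives
  \<open>w R w - z R z = (w - z) R w R z\<close> and \<open>R w - R z = (z - w) R w A R z\<close>.\<close>

lemma resolvent_has_derivative:
  fixes A :: "'a :: complex_hilbert \<Rightarrow>\<^sub>L 'a"
  assumes A: "A \<in> clinear_op" "norm A \<le> 1"
    and R: "\<And>z. z \<in> unit_disc \<Longrightarrow> R z \<in> clinear_op"
      "\<And>z. z \<in> unit_disc \<Longrightarrow> norm (R z) \<le> 1 / (1 - cmod z)"
      "\<And>z x. z \<in> unit_disc \<Longrightarrow> R z x + z *\<^sub>C A (R z x) = x"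
      "\<And>z x. z \<in> unit_disc \<Longrightarrow> R z (x + z *\<^sub>C A x) = x"
    and z: "z \<in> unit_disc"
  shows "((\<lambda>z. z *\<^sub>C R z) has_derivative (\<lambda>h. h *\<^sub>C (R z o\<^sub>L R z))) (at z)"
proof (rule has_derivative_quadratic_error[OF bounded_linear_scaleC_left])
  \<comment> \<open>Half the distance from \<open>z\<close> to the unit circle, so that
    \<open>1 / d\<close> bounds both \<open>R w\<close> and \<open>R z\<close>.\<close>
  define d where "d = (1 - cmod z) / 2"
  show "0 < d"
    using z by (simp add: d_def)
  fix w
  assume w: "norm (w - z) < d"
  have cw: "cmod w \<le> 1 - d"
    using norm_triangle_sub[of w z] w by (simp add: d_def field_simps)
  then have w1: "w \<in> unit_disc"
    using \<open>0 < d\<close> by simp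
  have "norm (R w) \<le> 1 / (1 - cmod w)"
    by (rule R(2)[OF w1])
  also have "\<dots> \<le> 1 / d"
    using cw \<open>0 < d\<close> by (intro divide_left_mono mult_pos_pos) auto
  finally have Rw: "norm (R w) \<le> 1 / d" .
  have "norm (R z) \<le> 1 / (1 - cmod z)"
    by (rule R(2)[OF z])
  also have "\<dots> \<le> 1 / d"
    using z \<open>0 < d\<close> by (intro divide_left_mono mult_pos_pos) (auto simp: d_def)
  finally have Rz: "norm (R z) \<le> 1 / d" .
  have diff: "R w - R z = (z - w) *\<^sub>C (R w o\<^sub>L (A o\<^sub>L R z))"
  proof (rule blinfun_eqI)
    fix x
    define y where "y = R z x"
    have x: "x = y + z *\<^sub>C A y"
      using R(3)[OF z, of x] by (simp add: y_def)
    have "x = (y + w *\<^sub>C A y) + (z - w) *\<^sub>C A y"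
      by (simp add: x scaleC_diff_left)
    then have "R w x = y + (z - w) *\<^sub>C R w (A y)"
      using R(4)[OF w1, of y] clinear_opD[OF R(1)[OF w1]] by (metis blinfun.add_right)
    then show "(R w - R z) x = ((z - w) *\<^sub>C (R w o\<^sub>L (A o\<^sub>L R z))) x"
      by (simp add: blinfun.diff_left scaleC_blinfun.rep_eq y_def)
  qed
  have prod: "w *\<^sub>C R w - z *\<^sub>C R z = (w - z) *\<^sub>C (R w o\<^sub>L R z)"
  proof (rule blinfun_eqI)
    fix x
    define y where "y = R z x"
    have x: "x = y + z *\<^sub>C A y"
      using R(3)[OF z, of x] by (simp add: y_def)
    have "w *\<^sub>C x = z *\<^sub>C (y + w *\<^sub>C A y) + (w - z) *\<^sub>C y"
      by (simp add: x scaleC_diff_left scaleC_add_right scaleC_scaleC mult.commute)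
    then have "R w (w *\<^sub>C x) = R w (z *\<^sub>C (y + w *\<^sub>C A y)) + R w ((w - z) *\<^sub>C y)"
      by (simp only: blinfun.add_right)
    then have "w *\<^sub>C R w x = z *\<^sub>C y + (w - z) *\<^sub>C R w y"
      by (simp only: R(4)[OF w1] clinear_opD[OF R(1)[OF w1]])
    then show "(w *\<^sub>C R w - z *\<^sub>C R z) x = ((w - z) *\<^sub>C (R w o\<^sub>L R z)) x"
      by (simp add: blinfun.diff_left scaleC_blinfun.rep_eq y_def)
  qed
  have "w *\<^sub>C R w - z *\<^sub>C R z - (w - z) *\<^sub>C (R z o\<^sub>L R z) = (w - z) *\<^sub>C ((R w - R z) o\<^sub>L R z)"
    unfolding prod by (rule blinfun_eqI)
      (simp add: blinfun.diff_left scaleC_blinfun.rep_eq scaleC_diff_right)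
  then have "norm (w *\<^sub>C R w - z *\<^sub>C R z - (w - z) *\<^sub>C (R z o\<^sub>L R z))
      = cmod (w - z) * norm ((R w - R z) o\<^sub>L R z)"
    by (simp add: norm_scaleC)
  also have "\<dots> \<le> cmod (w - z) * (norm (R w - R z) * norm (R z))"
    by (intro mult_left_mono norm_blinfun_compose) simp
  also have "\<dots> \<le> cmod (w - z) * ((cmod (w - z) * (1 / d * (1 * (1 / d)))) * (1 / d))"
  proof -
    have "norm (A o\<^sub>L R z) \<le> 1 * (1 / d)"
      by (intro order_trans[OF norm_blinfun_compose] mult_mono A Rz) auto
    then have "norm (R w o\<^sub>L (A o\<^sub>L R z)) \<le> 1 / d * (1 * (1 / d))"
      using \<open>0 < d\<close> by - (rule order_trans[OF norm_blinfun_compose], intro mult_mono Rw, auto)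
    then have "norm (R w - R z) \<le> cmod (w - z) * (1 / d * (1 * (1 / d)))"
      unfolding diff norm_scaleC norm_minus_commute[of z w] by (rule mult_left_mono) simp
    then show ?thesis
      using \<open>0 < d\<close> Rz by (intro mult_left_mono mult_mono) auto
  qed
  also have "\<dots> = (1 / d) ^ 3 * (norm (w - z))\<^sup>2"
    by (simp add: power2_eq_square power3_eq_cube)
  finally show "norm (w *\<^sub>C R w - z *\<^sub>C R z - (w - z) *\<^sub>C (R z o\<^sub>L R z)) \<le> (1 / d) ^ 3 * (norm (w - z))\<^sup>2" .
qed

lemma julia_identity:
  fixes T :: "'a :: complex_hilbert \<Rightarrow>\<^sub>L 'b :: complex_hilbert"
  assumes T: "T \<in> contractions"
  shows "(norm (T x + defect_op (adjoint_op T) w))\<^sup>2 + (norm (defect_op T x - adjoint_op T w))\<^sup>2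
    = (norm x)\<^sup>2 + (norm w)\<^sup>2"
proof -
  have adj: "adjoint_op T \<in> contractions"
    by (rule adjoint_op_contractions[OF T])
  have "cinner (defect_op T x) (adjoint_op T w) = cinner (T x) (defect_op (adjoint_op T) w)"
    using cinner_adjoint_op[OF contractionsD(1)[OF T]] defect_op_intertwines[OF T]
      defect_op_hermitian[OF adj] by metis
  then show ?thesis
    by (simp add: norm_add_sq norm_diff_sq norm_defect_op[OF T] norm_defect_op[OF adj])
qed

text \<open>The values of \<open>F\<close> are described through any solution \<open>v\<close> of
  the resolvent equation, so that the resolvent stays internal to the proof.\<close>

lemma schur_class_mobius:
  fixes T :: "'a :: complex_hilbert \<Rightarrow>\<^sub>L 'b :: complex_hilbert"
  assumes T: "T \<in> contractions" and W: "W \<in> contractions"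
  shows "\<exists>F\<in>schur_class. F 0 = T \<and> (\<forall>z\<in>unit_disc. \<forall>x v.
    v + z *\<^sub>C adjoint_op T (W v) = defect_op T x
      \<longrightarrow> blinfun_apply (F z) x = T x + defect_op (adjoint_op T) (z *\<^sub>C W v))"
proof -
  define D E A where "D = defect_op T" and "E = defect_op (adjoint_op T)" and "A = adjoint_op T o\<^sub>L W"
  have adj: "adjoint_op T \<in> contractions"
    by (rule adjoint_op_contractions[OF T])
  have D: "D \<in> clinear_op" and E: "E \<in> clinear_op"
    unfolding D_def E_def by (intro defect_op_clinear T adj)+
  have A: "A \<in> clinear_op" "norm A \<le> 1"
  proof -
    show "A \<in> clinear_op"
      unfolding A_def using adj W by (intro clinear_op_compose contractionsD)
    have "norm A \<le> norm (adjoint_op T) * norm W"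
      unfolding A_def by (rule norm_blinfun_compose)
    also have "\<dots> \<le> 1 * 1"
      using adj W by (intro mult_mono contractionsD) auto
    finally show "norm A \<le> 1"
      by simp
  qed
  have "\<exists>R\<in>clinear_op. norm R \<le> 1 / (1 - cmod z) \<and>
      (\<forall>x. blinfun_apply R x + z *\<^sub>C A (R x) = x) \<and> (\<forall>x. blinfun_apply R (x + z *\<^sub>C A x) = x)"
    if z: "z \<in> unit_disc" for z
  proof -
    have le: "norm (z *\<^sub>C A) \<le> cmod z"
      using A(2) mult_left_mono[of "norm A" 1 "cmod z"] by (simp add: norm_scaleC)
    with z have less: "norm (z *\<^sub>C A) < 1"
      by simp
    have "1 / (1 - norm (z *\<^sub>C A)) \<le> 1 / (1 - cmod z)"
      using le less z by (intro divide_left_mono mult_pos_pos) auto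
    with clinear_op_inverse_id_plus[OF clinear_op_scaleC[OF A(1)] less] show ?thesis
      by (auto simp: scaleC_blinfun.rep_eq intro: order_trans)
  qed
  then obtain R where R: "\<And>z. z \<in> unit_disc \<Longrightarrow> R z \<in> clinear_op"
      "\<And>z. z \<in> unit_disc \<Longrightarrow> norm (R z) \<le> 1 / (1 - cmod z)"
      "\<And>z x. z \<in> unit_disc \<Longrightarrow> blinfun_apply (R z) x + z *\<^sub>C A (R z x) = x"
      "\<And>z x. z \<in> unit_disc \<Longrightarrow> blinfun_apply (R z) (x + z *\<^sub>C A x) = x"
    by metis
  \<comment> \<open>A fixed bounded map applied to \<open>z *\<^sub>C R z\<close>, so that
    analyticity reduces to the derivative of the resolvent expression.\<close>
  define \<Phi> where "\<Phi> B = (E o\<^sub>L W) o\<^sub>L (B o\<^sub>L D)" for B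
  define F where "F z = T + \<Phi> (z *\<^sub>C R z)" for z
  have F: "F z x = T x + E (z *\<^sub>C W v)" if z: "z \<in> unit_disc" and v: "v + z *\<^sub>C A v = D x" for z x v
  proof -
    have "R z (D x) = v"
      unfolding v[symmetric] by (rule R(4)[OF z])
    then show ?thesis
      by (simp add: F_def \<Phi>_def blinfun.add_left scaleC_blinfun.rep_eq
          clinear_opD[OF contractionsD(1)[OF W]])
  qed
  have "F vector_analytic_on unit_disc"
    unfolding vector_analytic_on_def
  proof
    fix z
    assume z: "z \<in> unit_disc"
    have "bounded_linear \<Phi>"
      unfolding \<Phi>_def
      by (intro bounded_linear_compose[OF
            bounded_bilinear.bounded_linear_right[OF bounded_bilinear_blinfun_compose]
            bounded_bilinear.bounded_linear_left[OF bounded_bilinear_blinfun_compose]])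
    from bounded_linear.has_derivative[OF this resolvent_has_derivative[OF A R z]]
    have "(F has_derivative (\<lambda>h. \<Phi> (h *\<^sub>C (R z o\<^sub>L R z)))) (at z)"
      unfolding F_def using has_derivative_add[OF has_derivative_const[of T]] by fastforce
    moreover have "\<Phi> (h *\<^sub>C B) = h *\<^sub>C \<Phi> B" for h B
      by (rule blinfun_eqI)
        (simp add: \<Phi>_def scaleC_blinfun.rep_eq clinear_opD[OF E] clinear_opD[OF contractionsD(1)[OF W]])
    ultimately show "\<exists>D. (F has_derivative (\<lambda>h. h *\<^sub>C D)) (at z)"
      by auto
  qed
  moreover have "F z \<in> clinear_op \<and> norm (F z) \<le> 1" if z: "z \<in> unit_disc" for z
  proof
    show "F z \<in> clinear_op"
      unfolding F_def \<Phi>_def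
      by (intro clinear_op_add clinear_op_compose clinear_op_scaleC contractionsD(1) T W D E R(1) z)
    show "norm (F z) \<le> 1"
    proof (rule norm_blinfun_bound)
      fix x
      define v w where "v = R z (D x)" and "w = z *\<^sub>C W v"
      have v: "v + z *\<^sub>C A v = D x"
        unfolding v_def by (rule R(3)[OF z])
      have Dx: "D x - adjoint_op T w = v"
        by (simp add: v[symmetric] w_def A_def clinear_opD[OF contractionsD(1)[OF adj]])
      have Fx: "F z x = T x + E w"
        unfolding w_def by (rule F[OF z v])
      \<comment> \<open>The Julia identity balances \<open>F z x\<close> and \<open>v\<close>
        against \<open>x\<close> and \<open>w\<close>, so \<open>norm w \<le> norm v\<close> makes
        \<open>F z\<close> contractive.\<close>
      have "norm w \<le> 1 * norm v"
        unfolding w_def norm_scaleC using z by (intro mult_mono contractionsD W) auto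
      then have "(norm w)\<^sup>2 \<le> (norm v)\<^sup>2"
        by (simp add: power_mono)
      moreover have "(norm (F z x))\<^sup>2 + (norm v)\<^sup>2 = (norm x)\<^sup>2 + (norm w)\<^sup>2"
        using julia_identity[OF T, of x w, folded D_def E_def] unfolding Dx Fx .
      ultimately have "(norm (F z x))\<^sup>2 \<le> (norm x)\<^sup>2"
        by linarith
      then have "norm (F z x) \<le> norm x"
        by (rule power2_le_imp_le) simp
      then show "norm (F z x) \<le> 1 * norm x"
        by simp
    qed simp
  qed
  ultimately have "F \<in> schur_class"
    by (simp add: schur_class_def)
  moreover have "F 0 = T"
    by (rule blinfun_eqI)
      (simp add: F_def \<Phi>_def blinfun.add_left scaleC_blinfun.rep_eq blinfun.zero_right)
  moreover have "\<forall>z\<in>unit_disc. \<forall>x v. v + z *\<^sub>C adjoint_op T (W v) = defect_op T x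
      \<longrightarrow> blinfun_apply (F z) x = T x + defect_op (adjoint_op T) (z *\<^sub>C W v)"
    using F by (simp add: A_def D_def E_def)
  ultimately show ?thesis
    by blast
qed

section \<open>From Shmul'yan equivalence to a Schur function\<close>

text \<open>\<open>X\<close> is controlled only on the defect space, but \<open>X\<close> after
  \<open>defect_op T\<close> is a bounded operator \<open>h\<close> on the whole space. The absolute
  value enters because the definition leaves the sign of \<open>K\<close> open.\<close>

lemma shmulyan_dominatesE:
  fixes T T' :: "'a :: complex_hilbert \<Rightarrow>\<^sub>L 'b :: complex_hilbert"
  assumes "shmulyan_dominates T T'" and T: "T \<in> contractions"
  obtains h :: "'a \<Rightarrow>\<^sub>L 'b" and K where "h \<in> clinear_op" and "0 \<le> K"
    and "\<And>x. norm (h x) \<le> K * norm (defect_op T x)"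
    and "\<And>x. T' x = T x + defect_op (adjoint_op T) (h x)"
proof -
  obtain X where X: "bounded_op_between (defect_space T) (defect_space (adjoint_op T)) X"
    and T': "\<And>x. T' x = T x + defect_op (adjoint_op T) (X (defect_op T x))"
    using assms(1) unfolding shmulyan_dominates_def by blast
  have mem: "defect_op T x \<in> defect_space T" for x
    unfolding defect_space_def by (rule subsetD[OF closure_subset]) simp
  obtain K where K: "\<And>v. v \<in> defect_space T \<Longrightarrow> norm (X v) \<le> K * norm v"
    using X unfolding bounded_op_between_def by blast
  have le: "norm (X (defect_op T x)) \<le> \<bar>K\<bar> * norm (defect_op T x)" for x
    using K[OF mem[of x]] mult_right_mono[OF abs_ge_self[of K], of "norm (defect_op T x)"] by simp
  have "norm (defect_op T x) \<le> norm x" for x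
    using norm_defect_op[OF T, of x] by - (rule power2_le_imp_le, simp_all)
  then have "norm (X (defect_op T x)) \<le> \<bar>K\<bar> * norm x" for x
    using le[of x] mult_left_mono[of "norm (defect_op T x)" "norm x" "\<bar>K\<bar>"] by fastforce
  moreover have "X (defect_op T (x + y)) = X (defect_op T x) + X (defect_op T y)" for x y
    using X mem by (simp add: bounded_op_between_def blinfun.add_right)
  moreover have "X (defect_op T (c *\<^sub>C x)) = c *\<^sub>C X (defect_op T x)" for c x
    using X mem by (simp add: bounded_op_between_def clinear_opD[OF defect_op_clinear[OF T]])
  ultimately obtain h where "h \<in> clinear_op" "\<And>x. blinfun_apply h x = X (defect_op T x)"
    using clinear_opI[of "\<lambda>x. X (defect_op T x)" "\<bar>K\<bar>"] by auto
  with le T' show thesis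
    by (intro that[of h "\<bar>K\<bar>"]) auto
qed

lemma shmulyan_equivalent_imp_schur:
  fixes T T' :: "'a :: complex_hilbert \<Rightarrow>\<^sub>L 'b :: complex_hilbert"
  assumes T: "T \<in> contractions" and T': "T' \<in> contractions" and equiv: "shmulyan_equivalent T T'"
  shows "\<exists>l\<in>unit_disc. \<exists>F\<in>schur_class. F 0 = T \<and> F l = T'"
proof -
  obtain h K where h: "h \<in> clinear_op" "0 \<le> K"
      "\<And>x. norm (h x) \<le> K * norm (defect_op T x)"
      "\<And>x. T' x = T x + defect_op (adjoint_op T) (h x)"
    using equiv T by (auto simp: shmulyan_equivalent_def elim: shmulyan_dominatesE)
  obtain h' K' where h': "h' \<in> clinear_op" "0 \<le> K'"
      "\<And>x. norm (h' x) \<le> K' * norm (defect_op T' x)"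
      "\<And>x. T x = T' x + defect_op (adjoint_op T') (h' x)"
    using equiv T' by (auto simp: shmulyan_equivalent_def elim: shmulyan_dominatesE)
  have adj: "adjoint_op T \<in> contractions" "adjoint_op T' \<in> contractions"
    by (simp_all add: adjoint_op_contractions T T')
  \<comment> \<open>This is \<open>(1 - T* X) D_T\<close>, and \<open>h\<close> is
    \<open>X D_T\<close>.\<close>
  define g where "g = defect_op T - (adjoint_op T o\<^sub>L h)"
  have g: "g \<in> clinear_op" and g_app: "g x = defect_op T x - adjoint_op T (h x)" for x
    unfolding g_def
    by (intro clinear_op_diff clinear_op_compose defect_op_clinear T h adjoint_op_clinear contractionsD(1)[OF T])
      (simp add: blinfun.diff_left)
  \<comment> \<open>Using \<open>2 + K\<close> in place of \<open>1 + K\<close> forces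
    \<open>1 < M\<close>, so that \<open>r\<close> below is positive and \<open>Y\<close> can be
    divided by it.\<close>
  define M where "M = (2 + K) * (2 + K')"
  have M: "1 < M"
    using mult_mono[of 2 "2 + K" 2 "2 + K'"] h(2) h'(2) by (simp add: M_def)
  have upper: "norm (defect_op A x - adjoint_op A (k x)) \<le> (2 + c) * norm (defect_op A x)"
    if "A \<in> contractions" "norm (k x) \<le> c * norm (defect_op A x)"
    for A :: "'a \<Rightarrow>\<^sub>L 'b" and k :: "'a \<Rightarrow>\<^sub>L 'b" and c x
  proof -
    have "norm (adjoint_op A (k x)) \<le> c * norm (defect_op A x)"
      using contractionsD(3)[OF adjoint_op_contractions[OF that(1)], of "k x"] that(2) by simp
    then have "norm (defect_op A x - adjoint_op A (k x)) \<le> norm (defect_op A x) + c * norm (defect_op A x)"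
      by (intro norm_triangle_le_diff add_mono order_refl)
    also have "\<dots> \<le> (2 + c) * norm (defect_op A x)"
      by (simp add: algebra_simps)
    finally show ?thesis .
  qed
  \<comment> \<open>The Julia identity for \<open>T\<close> shows that the squared norm of
    \<open>defect_op T' x\<close> is the difference on the right; for \<open>T'\<close> it bounds
    \<open>defect_op T x\<close> by a multiple of \<open>defect_op T' x\<close>.\<close>
  have lower: "(norm (g x))\<^sup>2 \<le> M\<^sup>2 * ((norm (g x))\<^sup>2 - (norm (h x))\<^sup>2)" for x
  proof -
    have "(norm (defect_op T x))\<^sup>2 \<le> ((2 + K') * norm (defect_op T' x))\<^sup>2"
    proof -
      have "(norm (defect_op T x))\<^sup>2 + (norm (h' x))\<^sup>2
          = (norm (defect_op T' x - adjoint_op T' (h' x)))\<^sup>2"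
        using julia_identity[OF T', of x "h' x"] by (simp add: norm_defect_op[OF T] h'(4)[of x])
      moreover have "(norm (defect_op T' x - adjoint_op T' (h' x)))\<^sup>2 \<le> ((2 + K') * norm (defect_op T' x))\<^sup>2"
        by (intro power_mono upper T' h') simp
      ultimately show ?thesis
        using zero_le_power2[of "norm (h' x)"] by linarith
    qed
    moreover have "(norm (g x))\<^sup>2 \<le> ((2 + K) * norm (defect_op T x))\<^sup>2"
      unfolding g_app by (intro power_mono upper T h) simp
    moreover have "(norm (defect_op T' x))\<^sup>2 = (norm (g x))\<^sup>2 - (norm (h x))\<^sup>2"
      using julia_identity[OF T, of x "h x"] by (simp add: norm_defect_op[OF T'] h(4)[of x] g_app)
    ultimately show ?thesis
      using mult_left_mono[of "(norm (defect_op T x))\<^sup>2" "(2 + K')\<^sup>2 * (norm (defect_op T' x))\<^sup>2" "(2 + K)\<^sup>2"]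
      by (simp add: power_mult_distrib M_def mult.assoc)
  qed
  \<comment> \<open>Solving \<open>lower\<close> for \<open>norm (h x)\<close> gives this factor in
    front of \<open>norm (g x)\<close>.\<close>
  define r where "r = sqrt (1 - 1 / M\<^sup>2)"
  have M2: "1 < M\<^sup>2"
    using M by (simp add: one_less_power)
  then have "0 < 1 / M\<^sup>2" "1 / M\<^sup>2 < 1"
    using less_trans[OF zero_less_one M2] by (simp_all only: pos_divide_less_eq zero_less_divide_1_iff mult_1)
  then have r: "0 < r" "r < 1" "r\<^sup>2 = 1 - 1 / M\<^sup>2"
    by (simp_all add: r_def)
  have "norm (h x) \<le> r * norm (g x)" for x
  proof (rule power2_le_imp_le)
    show "(norm (h x))\<^sup>2 \<le> (r * norm (g x))\<^sup>2"
      using lower[of x] less_trans[OF zero_less_one M] by (simp add: power_mult_distrib r(3) field_simps)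
    show "0 \<le> r * norm (g x)"
      using r by simp
  qed
  then obtain Y where Y: "Y \<in> clinear_op" "norm Y \<le> r" "\<And>x. h x = blinfun_apply Y (g x)"
    using douglas_factorization[OF g h(1), of r] r by auto
  define W where "W = complex_of_real (1 / r) *\<^sub>C Y"
  have W: "W \<in> contractions"
    using Y r by (simp add: contractions_def W_def clinear_op_scaleC norm_scaleC norm_divide field_simps)
  have rW: "complex_of_real r *\<^sub>C W v = Y v" for v
    using r by (simp add: W_def scaleC_blinfun.rep_eq scaleC_scaleC scaleC_one)
  have disc: "complex_of_real r \<in> unit_disc"
    using r by simp
  from schur_class_mobius[OF T W] obtain F where F: "F \<in> schur_class" "F 0 = T"
      "\<And>z x v. z \<in> unit_disc \<Longrightarrow> v + z *\<^sub>C adjoint_op T (W v) = defect_op T x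
        \<Longrightarrow> blinfun_apply (F z) x = T x + defect_op (adjoint_op T) (z *\<^sub>C W v)"
    by blast
  have "F (complex_of_real r) x = T' x" for x
  proof -
    have "complex_of_real r *\<^sub>C adjoint_op T (W (g x)) = adjoint_op T (h x)"
      by (simp add: rW Y(3) flip: clinear_opD[OF contractionsD(1)[OF adj(1)]])
    \<comment> \<open>Thus \<open>v = g x\<close> solves the resolvent equation at
      \<open>z = r\<close>, where \<open>r W = Y\<close> sends it to \<open>h x\<close>.\<close>
    then have "g x + complex_of_real r *\<^sub>C adjoint_op T (W (g x)) = defect_op T x"
      by (simp add: g_app)
    from F(3)[OF disc this] show ?thesis
      by (simp add: rW h(4) Y(3))
  qed
  then have "F (complex_of_real r) = T'"
    by (rule blinfun_eqI)
  with F(1,2) disc show ?thesis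
    by blast
qed

lemma schur_imp_kobayashi_finite:
  assumes "l0 \<in> unit_disc" and "F \<in> schur_class" and "F 0 = T" and "F l0 = T'"
  shows "kobayashi_dist T T' < \<infinity>"
proof -
  have "kobayashi_dist T T' \<le> ennreal (\<Sum>j=1..1::nat. hyperbolic_dist 0 l0)"
    unfolding kobayashi_dist_def
    by (rule Inf_lower) (use assms in \<open>auto intro!: exI[of _ "1::nat"] exI[of _ "\<lambda>_. l0"] exI[of _ "\<lambda>_. F"]\<close>)
  also have "\<dots> < \<infinity>"
    by simp
  finally show ?thesis .
qed

theorem theorem3p1:
  fixes T T' :: "'a :: complex_hilbert \<Rightarrow>\<^sub>L 'b :: complex_hilbert"
  assumes "separable_space (euclidean :: 'a topology)"
    and "separable_space (euclidean :: 'b topology)"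
    and "T \<in> contractions"
    and "T' \<in> contractions"
  shows "(shmulyan_equivalent T T' \<longleftrightarrow>
           (\<exists>l0\<in>unit_disc. \<exists>F\<in>schur_class. F 0 = T \<and> F l0 = T')) \<and>
         ((\<exists>l0\<in>unit_disc. \<exists>F\<in>schur_class. F 0 = T \<and> F l0 = T') \<longleftrightarrow>
           kobayashi_dist T T' < \<infinity>)"
proof -
  \<comment> \<open>The implications form a cycle: Pick equivalence, Shmul'yan equivalence, a Schur
    function through both points, finite Kobayashi distance, and back.\<close>
  have "shmulyan_equivalent T T'" if "pick_equivalent T T'"
    unfolding shmulyan_equivalent_def
    by (intro conjI pick_equivalent_shmulyan_dominates assms(3,4) pick_equivalent_sym[OF that] that)
  moreover have "\<exists>l0\<in>unit_disc. \<exists>F\<in>schur_class. F 0 = T \<and> F l0 = T'" if "shmulyan_equivalent T T'"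
    by (rule shmulyan_equivalent_imp_schur[OF assms(3,4) that])
  moreover have "kobayashi_dist T T' < \<infinity>"
    if "\<exists>l0\<in>unit_disc. \<exists>F\<in>schur_class. F 0 = T \<and> F l0 = T'"
    using that schur_imp_kobayashi_finite by blast
  moreover have "pick_equivalent T T'" if "kobayashi_dist T T' < \<infinity>"
    by (rule kobayashi_finite_pick_equivalent[OF that])
  ultimately show ?thesis
    by blast
qed

end
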